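(* (i) For all $1<p<\infty$ there is uniform $p$-concentration on $\mathbb{Z}_q$. (ii) $\displaystyle \gamma_2^\sharp=\sup_{x>0}\frac{2\sin^2 x}{\pi x}=0.4613\cdots$. (iii) $0.495<\gamma_4^\sharp\le \tfrac12$. (iv) For all $p>2$, $\gamma_p^\sharp>0.483$. (v) For $0<p\le 1$ there is no uniform $p$-concentration on $\mathbb{Z}_q$.
   Context: For a positive integer $q$, $\mathbb{Z}_q=\mathbb{Z}/q\mathbb{Z}$, and $e_h(x)=e^{2\pi i hx/q}$ for $x\in\mathbb{Z}_q$. The set of idempotents on $\mathbb{Z}_q$ is $\mathcal{P}_q=\{\sum_{h\in H}e_h : H\subset\{0,\dots,q-1\}\}$. Let $p>0$. There is uniform (in $q$) $p$-concentration on $\mathbb{Z}_q$ if there exists a constant $\gamma>0$ such that for each prime number $q$ there is a nonzero $f\in\mathcal{P}_q$ with $$2|f(1)|^p\ \ge\ \gamma\sum_{k=0}^{q-1}|f(k)|^p .$$ For given $q$, $\gamma_p^\sharp(q)$ denotes the maximum of all constants $\gamma$ for which such an $f\in\mathcal{P}_q$ exists, and $\gamma_p^\sharp=\liminf_{q\to\infty}\gamma_p^\sharp(q)$, with $q$ running over primes. *)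

theory Defs
  imports "HOL-Analysis.Analysis" "HOL-Computational_Algebra.Primes"
begin

text \<open>
  Functions on $Z_q$ are represented by \<open>q\<close>-periodic functions on the integers, and
  residues by their representatives in \<open>{0..<q}\<close>.
\<close>

definition zq_char :: "nat \<Rightarrow> int \<Rightarrow> int \<Rightarrow> complex" where
  "zq_char q h x = exp (2 * of_real pi * \<i> * of_int h * of_int x / of_nat q)"

definition idempotents :: "nat \<Rightarrow> (int \<Rightarrow> complex) set" where
  "idempotents q = {(\<lambda>x. \<Sum>h\<in>H. zq_char q h x) | H. H \<subseteq> {0..<int q}}"

definition concentrated :: "real \<Rightarrow> nat \<Rightarrow> real \<Rightarrow> bool" where
  "concentrated p q \<gamma> \<longleftrightarrow>
     (\<exists>f\<in>idempotents q. f \<noteq> (\<lambda>_. 0) \<and>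
        2 * cmod (f 1) powr p \<ge> \<gamma> * (\<Sum>k\<in>{0..<int q}. cmod (f k) powr p))"

definition uniform_concentration :: "real \<Rightarrow> bool" where
  "uniform_concentration p \<longleftrightarrow> (\<exists>\<gamma>>0. \<forall>q. prime q \<longrightarrow> concentrated p q \<gamma>)"

text \<open>The maximum is attained for \<open>q > 0\<close>, see \<open>gamma_sharp_q_Greatest\<close> below.\<close>

definition gamma_sharp_q :: "real \<Rightarrow> nat \<Rightarrow> real" where
  "gamma_sharp_q p q = (GREATEST \<gamma>. concentrated p q \<gamma>)"

text \<open>The lower limit is taken along the primes, i.e. along \<open>at_top\<close> restricted to them.\<close>

definition gamma_sharp :: "real \<Rightarrow> ereal" where
  "gamma_sharp p =
     Liminf (inf at_top (principal {q::nat. prime q})) (\<lambda>q. ereal (gamma_sharp_q p q))"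

lemma zq_char_periodic:
  assumes "q > 0"
  shows "zq_char q h (x + int q) = zq_char q h x"
proof -
  have "2 * of_real pi * \<i> * of_int h * of_int (x + int q) / of_nat q
      = 2 * of_real pi * \<i> * of_int h * of_int x / of_nat q
        + of_int (2 * h) * (of_real pi * \<i>)"
    using assms by (simp add: field_simps)
  then show ?thesis
    unfolding zq_char_def by (simp add: exp_add exp_eq_1 mult.assoc)
qed

lemma finite_idempotents: "finite (idempotents q)"
proof -
  have "idempotents q = (\<lambda>H x. \<Sum>h\<in>H. zq_char q h x) ` Pow {0..<int q}"
    by (auto simp: idempotents_def)
  then show ?thesis by simp
qed

lemma sum_powr_pos:
  assumes "q > 0" "f \<in> idempotents q" "f \<noteq> (\<lambda>_. 0)"
  shows "(\<Sum>k\<in>{0..<int q}. cmod (f k) powr p) > 0"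
proof -
  obtain H where H: "H \<subseteq> {0..<int q}" "f = (\<lambda>x. \<Sum>h\<in>H. zq_char q h x)"
    using assms(2) by (auto simp: idempotents_def)
  have "finite H" "H \<noteq> {}"
    using H assms(3) finite_subset by auto
  moreover have "f 0 = of_nat (card H)"
    by (simp add: H zq_char_def)
  ultimately have "cmod (f 0) powr p > 0"
    by simp
  then show ?thesis
    using assms(1) by (intro sum_pos2[of _ 0]) auto
qed

lemma gamma_sharp_q_Greatest:
  assumes "q > 0"
  shows "concentrated p q (gamma_sharp_q p q)"
    and "concentrated p q \<gamma> \<Longrightarrow> \<gamma> \<le> gamma_sharp_q p q"
proof -
  define F where "F = idempotents q - {\<lambda>_. 0}"
  define S where "S f = (\<Sum>k\<in>{0..<int q}. cmod (f k) powr p)" for f :: "int \<Rightarrow> complex"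
  define r where "r f = 2 * cmod (f 1) powr p / S f" for f
  have "(\<lambda>x. zq_char q 0 x) \<in> idempotents q"
    using assms by (auto simp: idempotents_def intro!: exI[of _ "{0}"])
  moreover have "(\<lambda>x. zq_char q 0 x) \<noteq> (\<lambda>_. 0)"
    by (auto simp: zq_char_def fun_eq_iff)
  ultimately have ne: "F \<noteq> {}" by (auto simp: F_def)
  have fin: "finite F" by (simp add: F_def finite_idempotents)
  have pos: "S f > 0" if "f \<in> F" for f
    using sum_powr_pos[OF assms] that by (auto simp: F_def S_def)
  have *: "concentrated p q c \<longleftrightarrow> (\<exists>f\<in>F. c \<le> r f)" for c
    using pos by (auto simp: concentrated_def F_def r_def S_def[symmetric] field_simps)
  have max: "concentrated p q (Max (r ` F))"
    unfolding * using Max_in[of "r ` F"] fin ne by fastforce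
  have ub: "c \<le> Max (r ` F)" if "concentrated p q c" for c
    using that fin unfolding * by (meson Max_ge finite_imageI image_eqI order_trans)
  have "gamma_sharp_q p q = Max (r ` F)"
    unfolding gamma_sharp_q_def using max ub by (rule Greatest_equality)
  then show "concentrated p q (gamma_sharp_q p q)"
    and "concentrated p q \<gamma> \<Longrightarrow> \<gamma> \<le> gamma_sharp_q p q"
    using max ub by auto
qed

end

theory Submission
  imports Defs "HOL-Number_Theory.Cong"
begin

text \<open>
  Write \<open>f = \<Sum>h\<in>H. e\<^sub>h\<close>, so that \<open>f 1\<close> is a sum of \<open>q\<close>-th roots of unity, one for each element of
  \<open>H\<close>. Parseval's identity \<open>\<Sum>|f k|\<^sup>2 = q |H|\<close> limits how small the other values can be.

  \<^item> \<open>p > 1\<close>: the Dirichlet kernel of length about \<open>q / 2\<close> satisfies \<open>|f 1| \<ge> q / 6\<close> and \<open>|f k| \<le> q / |k|\<close>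
    for \<open>|k| < q / 2\<close>, and \<open>\<Sum>k powr - p\<close> converges.

  \<^item> \<open>p = 2\<close>: the denominator depends on \<open>|H|\<close> only, so the best \<open>H\<close> of size \<open>n\<close> is the one that
    maximises \<open>|f 1|\<close>. This is an interval (\<open>norm_idem_at_1_le\<close>), with value
    \<open>sin (pi n / q) / sin (pi / q)\<close>; putting \<open>x = pi n / q\<close> gives \<open>2 sin\<^sup>2 x / (pi x)\<close> in the limit.

  \<^item> \<open>p = 4\<close>: \<open>|f|\<^sup>2\<close> has the nonnegative coefficients \<open>c m = #{(a, b) \<in> H \<times> H. a - b \<equiv> m}\<close>, and
    \<open>\<Sum>|f k|^4 = q \<Sum>(c m)\<^sup>2\<close>. Only the part of \<open>cos (2 pi m / q)\<close> where the cosine is positive helps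
    \<open>|f 1|\<^sup>2 = \<Sum>c m cos (2 pi m / q)\<close>, and its mean square is \<open>1 / 4\<close>; by Cauchy-Schwarz the constant is at
    most \<open>2 \<cdot> 1 / 4\<close>. Intervals of length \<open>0.85 q / pi\<close> come close to this.

  \<^item> \<open>p > 2\<close>: here \<open>0\<close>-\<open>1\<close> coefficients are as good as arbitrary weights \<open>w h \<in> [0, 1]\<close>, because \<open>w\<close> can be
    rounded with a Fourier error that is uniformly \<open>o(q)\<close> and has \<open>l\<^sup>2\<close> norm at most \<open>q\<close>
    (\<open>exists_rounding\<close>), hence is \<open>o(q powr p)\<close> in the sum of \<open>p\<close>-th powers. Weights
    with the Gaussian transform \<open>\<rho>^(k\<^sup>2)\<close>, where \<open>\<rho> powr p = r\<close>, give the ratio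
    \<open>2 r / (1 + 2 \<Sum>k\<ge>1. r^(k\<^sup>2))\<close>, in which \<open>p\<close> does not occur. At \<open>r = 3 / 5\<close> it exceeds \<open>0.4838\<close>.

  \<^item> \<open>p \<le> 1\<close>: concentration with a constant \<open>\<gamma>\<close> would make \<open>(1 / q) \<Sum>|f k|\<close> bounded for a set \<open>H\<close> whose
    density stays away from \<open>0\<close> and \<open>1\<close>. That is impossible for large \<open>q\<close>, a qualitative Littlewood
    theorem modulo primes (\<open>no_indicator_expansion\<close>). Along a progression \<open>x, x + t, \<dots>, x + (L - 1) t\<close>
    the mean of the indicator varies slowly with \<open>x\<close>, so it takes a value away from \<open>0\<close> and \<open>1\<close>, and
    the indicator has a definite variance there. Frequencies that are almost constant along the
    progression cannot produce variance, so a definite amount of Fourier mass lies on the others, and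
    a definite part of it belongs to frequencies clustering so tightly around \<open>0\<close> and some \<open>- m\<close> that
    they become almost constant after passing to a step \<open>s t\<close> with \<open>s m t / q\<close> close to an integer and
    to a much shorter length. Repeating this consumes a fixed amount of mass each time, while the
    total is bounded.
\<close>

section \<open>Characters and Fourier analysis modulo q\<close>

lemma zq_char_eq_cis: "zq_char q h x = cis (2 * pi * of_int h * of_int x / of_nat q)"
  unfolding zq_char_def cis_conv_exp by (intro arg_cong[where f = exp]) simp

lemma norm_zq_char [simp]: "cmod (zq_char q h x) = 1"
  by (simp add: zq_char_eq_cis)

lemma zq_char_0_left [simp]: "zq_char q 0 x = 1"
  by (simp add: zq_char_def)

lemma zq_char_0_right [simp]: "zq_char q h 0 = 1"
  by (simp add: zq_char_def)

lemma zq_char_commute: "zq_char q h x = zq_char q x h"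
  by (simp add: zq_char_def mult_ac)

lemma zq_char_add_left: "zq_char q (h + h') x = zq_char q h x * zq_char q h' x"
  unfolding zq_char_eq_cis cis_mult
  by (intro arg_cong[where f = cis]) (simp add: field_simps add_divide_distrib)

lemma zq_char_add_right: "zq_char q h (x + y) = zq_char q h x * zq_char q h y"
  by (metis zq_char_add_left zq_char_commute)

lemma cnj_zq_char: "cnj (zq_char q h x) = zq_char q (- h) x"
  by (simp add: zq_char_eq_cis cis_cnj)

lemma zq_char_minus_right: "zq_char q h (- x) = cnj (zq_char q h x)"
  by (metis cnj_zq_char zq_char_commute)

lemma zq_char_diff_left: "zq_char q (h - h') x = zq_char q h x * cnj (zq_char q h' x)"
  using zq_char_add_left[of q h "- h'" x] by (simp add: cnj_zq_char)

lemma zq_char_mult: "zq_char q (a * h) x = zq_char q h (a * x)"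
  by (simp add: zq_char_def mult_ac)

lemma zq_char_power: "zq_char q (int n * h) x = zq_char q h x ^ n"
  by (induction n) (simp_all add: zq_char_add_left distrib_right)

lemma zq_char_eq_1_iff:
  assumes "q > 0"
  shows "zq_char q h x = 1 \<longleftrightarrow> int q dvd h * x"
proof -
  have "zq_char q h x = 1 \<longleftrightarrow> (\<exists>n::int. 2 * pi * of_int h * of_int x / of_nat q = of_int (2 * n) * pi)"
    unfolding zq_char_eq_cis cis_conv_exp exp_eq_1 by simp
  also have "\<dots> \<longleftrightarrow> (\<exists>n::int. real_of_int (h * x) = of_int (n * int q))"
    using assms by (intro arg_cong[where f = Ex] ext) (simp add: field_simps)
  also have "\<dots> \<longleftrightarrow> int q dvd h * x"
    unfolding of_int_eq_iff by (auto simp: dvd_def mult_ac)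
  finally show ?thesis .
qed

lemma zq_char_cong:
  assumes "q > 0" "int q dvd h - h'"
  shows "zq_char q h x = zq_char q h' x"
proof -
  have "zq_char q (h - h') x = 1"
    using assms by (simp add: zq_char_eq_1_iff)
  then show ?thesis
    using zq_char_add_left[of q "h - h'" h' x] by simp
qed

lemma zq_char_mod: "q > 0 \<Longrightarrow> zq_char q (h mod int q) x = zq_char q h x"
  by (rule zq_char_cong) (auto simp: mod_eq_dvd_iff[symmetric])

lemma sum_int_atLeast0: "(\<Sum>k\<in>{0..<int q}. g k) = (\<Sum>i<q. g (int i))"
  by (rule sum.reindex_bij_witness[of _ int nat]) auto

lemma sum_zq_char:
  assumes "q > 0"
  shows "(\<Sum>k\<in>{0..<int q}. zq_char q m k) = (if int q dvd m then of_nat q else 0)"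
proof -
  define z where "z = zq_char q m 1"
  have "zq_char q m (int i) = z ^ i" for i
    using zq_char_power[of q i m 1] zq_char_mult[of q "int i" m 1] by (simp add: z_def)
  then have "(\<Sum>k\<in>{0..<int q}. zq_char q m k) = (\<Sum>i<q. z ^ i)"
    by (simp add: sum_int_atLeast0)
  moreover have "z ^ q = 1"
    using assms zq_char_power[of q q m 1] by (simp add: z_def zq_char_eq_1_iff flip: zq_char_power)
  moreover have "z = 1 \<longleftrightarrow> int q dvd m"
    using assms by (simp add: z_def zq_char_eq_1_iff)
  ultimately show ?thesis
    by (auto simp: sum_gp_strict)
qed

text \<open>
  The frequencies only have to be distinct modulo \<open>q\<close>, so that windows around \<open>0\<close>, which carry the
  differences of elements of \<open>H\<close>, are covered too.
\<close>

lemma Parseval: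
  fixes c :: "int \<Rightarrow> complex"
  assumes "q > 0" "finite S" and inj: "\<And>h h'. h \<in> S \<Longrightarrow> h' \<in> S \<Longrightarrow> int q dvd h - h' \<Longrightarrow> h = h'"
  shows "(\<Sum>k\<in>{0..<int q}. (cmod (\<Sum>h\<in>S. c h * zq_char q h k))\<^sup>2) = q * (\<Sum>h\<in>S. (cmod (c h))\<^sup>2)"
proof -
  have "complex_of_real ((cmod (\<Sum>h\<in>S. c h * zq_char q h k))\<^sup>2)
      = (\<Sum>h\<in>S. \<Sum>h'\<in>S. c h * cnj (c h') * zq_char q (h - h') k)" for k
    unfolding complex_norm_square by (simp add: sum_product zq_char_diff_left mult_ac)
  then have "complex_of_real (\<Sum>k\<in>{0..<int q}. (cmod (\<Sum>h\<in>S. c h * zq_char q h k))\<^sup>2)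
      = (\<Sum>k\<in>{0..<int q}. \<Sum>h\<in>S. \<Sum>h'\<in>S. c h * cnj (c h') * zq_char q (h - h') k)"
    by simp
  also have "\<dots> = (\<Sum>h\<in>S. \<Sum>h'\<in>S. c h * cnj (c h') * (\<Sum>k\<in>{0..<int q}. zq_char q (h - h') k))"
    by (subst sum.swap, rule sum.cong[OF refl], subst sum.swap) (simp add: sum_distrib_left)
  also have "\<dots> = (\<Sum>h\<in>S. \<Sum>h'\<in>S. if h' = h then c h * cnj (c h') * of_nat q else 0)"
    using inj by (intro sum.cong refl) (auto simp: sum_zq_char[OF assms(1)])
  also have "\<dots> = (\<Sum>h\<in>S. of_real (q * (cmod (c h))\<^sup>2))"
    unfolding of_real_mult complex_norm_square using assms(2) by (simp add: mult_ac)
  finally have "complex_of_real (\<Sum>k\<in>{0..<int q}. (cmod (\<Sum>h\<in>S. c h * zq_char q h k))\<^sup>2)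
      = of_real (q * (\<Sum>h\<in>S. (cmod (c h))\<^sup>2))"
    by (simp add: sum_distrib_left)
  then show ?thesis
    by (simp only: of_real_eq_iff)
qed

lemma dvd_diff_window:
  fixes a h h' :: int
  assumes "h \<in> {a..<a + int q}" "h' \<in> {a..<a + int q}" "int q dvd h - h'"
  shows "h = h'"
proof -
  have "\<bar>h - h'\<bar> < int q"
    using assms by auto
  then show ?thesis
    using assms(3) zdvd_not_zless[of "\<bar>h - h'\<bar>" "int q"] by (cases "h = h'") auto
qed

lemma Parseval_window:
  fixes c :: "int \<Rightarrow> complex"
  assumes "q > 0" "S \<subseteq> {a..<a + int q}"
  shows "(\<Sum>k\<in>{0..<int q}. (cmod (\<Sum>h\<in>S. c h * zq_char q h k))\<^sup>2) = q * (\<Sum>h\<in>S. (cmod (c h))\<^sup>2)"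
  using assms by (intro Parseval) (auto intro: finite_subset dvd_diff_window)

lemma Parseval_set:
  assumes "q > 0" "H \<subseteq> {0..<int q}"
  shows "(\<Sum>k\<in>{0..<int q}. (cmod (\<Sum>h\<in>H. zq_char q h k))\<^sup>2) = q * real (card H)"
  using Parseval_window[of q H 0 "\<lambda>_. 1"] assms by simp

lemma sum_periodic_window:
  fixes g :: "int \<Rightarrow> 'a::ab_group_add"
  assumes "\<And>x. g (x + int q) = g x"
  shows "sum g {a..<a + int q} = sum g {0..<int q}"
proof -
  have step: "sum g {b + 1..<b + 1 + int q} = sum g {b..<b + int q}" for b
  proof (cases "q = 0")
    case False
    then have "{b..<b + int q} = insert b {b + 1..<b + int q}"
      "{b + 1..<b + 1 + int q} = insert (b + int q) {b + 1..<b + int q}"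
      by auto
    then show ?thesis
      using assms by simp
  qed simp
  show ?thesis
  proof (induction a rule: int_induct[where k = 0])
    case (step2 i)
    then show ?case using step[of "i - 1"] by simp
  qed (use step in simp_all)
qed

lemma sum_symmetric_interval:
  fixes g :: "int \<Rightarrow> real"
  assumes even: "\<And>x. g (- x) = g x"
  shows "sum g {- int m..int m} = g 0 + 2 * (\<Sum>j=1..m. g (int j))"
proof -
  have "{- int m..int m} = insert 0 ({1..int m} \<union> uminus ` {1..int m})"
    unfolding image_uminus_atLeastAtMost by auto
  also have "sum g \<dots> = g 0 + (sum g {1..int m} + sum g (uminus ` {1..int m}))"
    by (subst sum.insert, (auto)[2], subst sum.union_disjoint) auto
  also have "sum g (uminus ` {1..int m}) = sum g {1..int m}"
    by (subst sum.reindex) (auto simp: even)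
  also have "sum g {1..int m} = (\<Sum>j=1..m. g (int j))"
    by (rule sum.reindex_bij_witness[of _ int nat]) auto
  finally show ?thesis by simp
qed

text \<open>
  Folding the residues onto \<open>0..m\<close> turns a summand that is small away from both ends of \<open>{0..<q}\<close> into
  one that decays in a single direction.
\<close>

lemma sum_periodic_even:
  fixes g :: "int \<Rightarrow> real"
  assumes per: "\<And>x. g (x + int q) = g x" and even: "\<And>x. g (- x) = g x" and q: "q = 2 * m + 1"
  shows "sum g {0..<int q} = g 0 + 2 * (\<Sum>j=1..m. g (int j))"
proof -
  have "sum g {0..<int q} = sum g {- int m..<- int m + int q}"
    by (rule sum_periodic_window[where g = g, symmetric]) (rule per)
  also have "{- int m..<- int m + int q} = {- int m..int m}"
    unfolding q by auto
  finally show ?thesis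
    by (simp add: sum_symmetric_interval[where g = g, OF even])
qed

definition idem :: "nat \<Rightarrow> int set \<Rightarrow> int \<Rightarrow> complex" where
  "idem q H k = (\<Sum>h\<in>H. zq_char q h k)"

lemma idempotents_eq: "idempotents q = idem q ` Pow {0..<int q}"
  by (auto simp: idempotents_def idem_def fun_eq_iff image_iff)

lemma concentrated_iff:
  "concentrated p q \<gamma> \<longleftrightarrow> (\<exists>H\<subseteq>{0..<int q}. idem q H \<noteq> (\<lambda>_. 0) \<and>
     \<gamma> * (\<Sum>k\<in>{0..<int q}. cmod (idem q H k) powr p) \<le> 2 * cmod (idem q H 1) powr p)"
  unfolding concentrated_def idempotents_eq by blast

lemma idem_0: "idem q H 0 = of_nat (card H)"
  by (simp add: idem_def)

lemma idem_nonzero: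
  assumes "H \<subseteq> {0..<int q}" "H \<noteq> {}"
  shows "idem q H \<noteq> (\<lambda>_. 0)"
proof -
  have "finite H" using assms finite_subset by blast
  then have "idem q H 0 \<noteq> 0"
    using assms by (simp add: idem_0)
  then show ?thesis by metis
qed

lemma norm_idem_minus: "cmod (idem q H (- k)) = cmod (idem q H k)"
proof -
  have "idem q H (- k) = cnj (idem q H k)"
    by (simp add: idem_def zq_char_minus_right)
  then show ?thesis by simp
qed

lemma idem_periodic: "q > 0 \<Longrightarrow> idem q H (k + int q) = idem q H k"
  by (simp add: idem_def zq_char_periodic)

section \<open>Dirichlet kernels\<close>

lemma norm_zq_char_minus_1: "cmod (zq_char q h x - 1) = 2 * \<bar>sin (pi * of_int h * of_int x / q)\<bar>"
  using dist_exp_i_1[of "2 * pi * of_int h * of_int x / q"]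
  by (simp add: zq_char_eq_cis cis_conv_exp mult_ac)

text \<open>
  The geometric sum in product form, which stays valid when \<open>k\<close> is a multiple of \<open>q\<close>.
\<close>

lemma norm_Dirichlet_kernel:
  "cmod (\<Sum>h\<in>{a..<a + int n}. zq_char q h k) * \<bar>sin (pi * of_int k / q)\<bar> = \<bar>sin (pi * n * of_int k / q)\<bar>"
proof -
  have "(\<Sum>h\<in>{a..<a + int n}. zq_char q h k) = (\<Sum>i<n. zq_char q (a + int i) k)"
    by (rule sum.reindex_bij_witness[of _ "\<lambda>i. a + int i" "\<lambda>h. nat (h - a)"]) auto
  also have "\<dots> = zq_char q a k * (\<Sum>i<n. zq_char q 1 k ^ i)"
    using zq_char_power[of q _ 1 k] by (simp add: zq_char_add_left sum_distrib_left)
  finally have "(\<Sum>h\<in>{a..<a + int n}. zq_char q h k) * (zq_char q 1 k - 1)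
      = zq_char q a k * (zq_char q 1 k ^ n - 1)"
    by (simp add: power_diff_1_eq mult_ac)
  then have "cmod (\<Sum>h\<in>{a..<a + int n}. zq_char q h k) * cmod (zq_char q 1 k - 1)
      = cmod (zq_char q (int n) k - 1)"
    using zq_char_power[of q n 1 k] by (metis norm_mult norm_zq_char mult_1 mult.right_neutral)
  then show ?thesis
    by (simp add: norm_zq_char_minus_1)
qed

lemma sin_pi_div_pos: "q \<ge> 2 \<Longrightarrow> sin (pi / real q) > 0"
  by (rule sin_gt_zero) (auto simp: field_simps)

lemma norm_Dirichlet_kernel_at_1:
  assumes "q \<ge> 2" "n \<le> q"
  shows "cmod (\<Sum>h\<in>{a..<a + int n}. zq_char q h 1) = sin (pi * n / q) / sin (pi / q)"
proof -
  have "sin (pi * n / q) \<ge> 0"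
    using assms by (intro sin_ge_zero) (auto simp: field_simps)
  then show ?thesis
    using norm_Dirichlet_kernel[of q 1 a n] sin_pi_div_pos[OF assms(1)] by (simp add: field_simps)
qed

section \<open>Concentration constants\<close>

lemma gamma_sharp_q_ge:
  assumes "q > 0" "H \<subseteq> {0..<int q}" "H \<noteq> {}"
    and "c * (\<Sum>k\<in>{0..<int q}. cmod (idem q H k) powr p) \<le> 2 * cmod (idem q H 1) powr p"
  shows "c \<le> gamma_sharp_q p q"
  using assms(2,4) idem_nonzero[OF assms(2,3)]
  by (intro gamma_sharp_q_Greatest(2)[OF assms(1)]) (auto simp: concentrated_iff)

lemma gamma_sharp_q_le:
  assumes "q > 0"
    and le: "\<And>H. H \<subseteq> {0..<int q} \<Longrightarrow> H \<noteq> {} \<Longrightarrow>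
      2 * cmod (idem q H 1) powr p \<le> c * (\<Sum>k\<in>{0..<int q}. cmod (idem q H k) powr p)"
  shows "gamma_sharp_q p q \<le> c"
proof -
  obtain H where H: "H \<subseteq> {0..<int q}" and nz: "idem q H \<noteq> (\<lambda>_. 0)"
    and c: "gamma_sharp_q p q * (\<Sum>k\<in>{0..<int q}. cmod (idem q H k) powr p) \<le> 2 * cmod (idem q H 1) powr p"
    using gamma_sharp_q_Greatest(1)[OF assms(1)] unfolding concentrated_iff by blast
  have "H \<noteq> {}"
    using nz by (auto simp: idem_def fun_eq_iff)
  then have "gamma_sharp_q p q * (\<Sum>k\<in>{0..<int q}. cmod (idem q H k) powr p)
      \<le> c * (\<Sum>k\<in>{0..<int q}. cmod (idem q H k) powr p)"
    using le[OF H] c by simp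
  moreover have "idem q H \<in> idempotents q"
    using H by (simp add: idempotents_eq)
  ultimately show ?thesis
    using sum_powr_pos[OF assms(1) _ nz] by (simp only: mult_le_cancel_right_pos)
qed

lemma eventually_primes:
  assumes "\<And>q. prime q \<Longrightarrow> q \<ge> N \<Longrightarrow> P q"
  shows "eventually P (inf at_top (principal {q::nat. prime q}))"
  unfolding eventually_inf_principal using eventually_ge_at_top[of N] by eventually_elim (use assms in auto)

lemma primes_at_top_neq_bot: "inf at_top (principal {q::nat. prime q}) \<noteq> bot"
proof
  assume "inf at_top (principal {q::nat. prime q}) = bot"
  then have "eventually (\<lambda>q::nat. \<not> prime q) at_top"
    using eventually_inf_principal[of "\<lambda>_. False" at_top "{q::nat. prime q}"] by simp
  then obtain N :: nat where "\<And>q. q \<ge> N \<Longrightarrow> \<not> prime q"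
    unfolding eventually_at_top_linorder by blast
  then show False
    using bigger_prime[of N] by (meson less_imp_le)
qed

lemma Liminf_primes:
  assumes "r \<longlonglongrightarrow> l"
  shows "Liminf (inf at_top (principal {q::nat. prime q})) (\<lambda>q. ereal (r q)) = ereal l"
  by (intro lim_imp_Liminf primes_at_top_neq_bot tendsto_ereal tendsto_mono[OF inf_le1 assms])

text \<open>
  The bound has to hold for large primes only, but its limit is taken along all natural numbers, where
  the usual limit laws apply directly.
\<close>

lemma gamma_sharp_ge:
  assumes "\<And>q. prime q \<Longrightarrow> q \<ge> N \<Longrightarrow> r q \<le> gamma_sharp_q p q" and "r \<longlonglongrightarrow> l"
  shows "ereal l \<le> gamma_sharp p"
  unfolding gamma_sharp_def Liminf_primes[OF assms(2), symmetric]
  by (intro Liminf_mono eventually_primes[of N]) (simp add: assms(1))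

lemma gamma_sharp_le:
  assumes "\<And>q. prime q \<Longrightarrow> q \<ge> N \<Longrightarrow> gamma_sharp_q p q \<le> r q" and "r \<longlonglongrightarrow> l"
  shows "gamma_sharp p \<le> ereal l"
  unfolding gamma_sharp_def Liminf_primes[OF assms(2), symmetric]
  by (intro Liminf_mono eventually_primes[of N]) (simp add: assms(1))

section \<open>Uniform concentration for exponents above one\<close>

lemma pi_bounds: "31415926 / 10000000 \<le> pi" "pi \<le> 31415927 / 10000000"
  using pi_approx by simp_all

text \<open>
  The cubic Taylor bound; the constant is crude but suffices to compare \<open>sin (pi k / q)\<close> with \<open>k / q\<close>.
\<close>

lemma sin_ge_half:
  fixes x :: real
  assumes "0 \<le> x" "x \<le> pi / 2"
  shows "x / 2 \<le> sin x"
proof -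
  have "x \<le> 1.6"
    using assms(2) pi_bounds by linarith
  then have "x * x \<le> 1.6 * 1.6"
    using assms(1) by (intro mult_mono) auto
  then have "x * (x * x / 6) \<le> x * (1 / 2)"
    using assms(1) by (intro mult_left_mono) auto
  moreover have "\<bar>sin x - x\<bar> \<le> x ^ 3 / 6"
    using Maclaurin_sin_bound[of x 3] assms(1)
    by (simp add: sin_coeff_def eval_nat_numeral field_simps)
  moreover have "x ^ 3 / 6 = x * (x * x / 6)"
    by (simp add: power3_eq_cube)
  ultimately show ?thesis
    by linarith
qed

lemma odd_prime_decomp:
  assumes "prime (q::nat)" "q \<noteq> 2"
  obtains m where "q = 2 * m + 1" "m \<ge> 1"
proof -
  have "odd q" "q \<ge> 2"
    using assms prime_odd_nat[of q] prime_ge_2_nat[of q] by auto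
  then obtain m where "q = 2 * m + 1"
    by (elim oddE)
  then show ?thesis
    using that \<open>q \<ge> 2\<close> by auto
qed

text \<open>
  The interval of length \<open>(q + 1) / 2\<close> is used: its angle \<open>pi (m + 1) / q\<close> is close enough to \<open>pi / 2\<close> for
  \<open>|f 1|\<close> to be of order \<open>q\<close>, whereas \<open>|f k| \<le> q / k\<close> for \<open>1 \<le> k \<le> q / 2\<close> holds for every interval.
\<close>

theorem uniform_concentration_above_one:
  assumes p: "p > 1"
  shows "uniform_concentration p"
proof -
  have sm: "summable (\<lambda>k. real k powr - p)"
    using p by (simp add: summable_real_powr_iff)
  define Z where "Z = (\<Sum>k. real k powr - p)"
  have Z: "Z \<ge> 0"
    unfolding Z_def by (intro suminf_nonneg sm) auto
  define \<gamma> where "\<gamma> = 2 / (6 powr p * (1 + 2 * Z))"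
  have \<gamma>0: "\<gamma> > 0"
    using Z by (simp add: \<gamma>_def)
  have "(6::real) powr p \<ge> 6 powr 1"
    using p by (intro powr_mono) auto
  then have "6 powr p * (1 + 2 * Z) \<ge> 6 * 1"
    using Z by (intro mult_mono) auto
  then have \<gamma>1: "\<gamma> \<le> 1"
    unfolding \<gamma>_def by simp
  have "concentrated p q \<gamma>" if q: "prime q" for q
  proof (cases "q = 2")
    case True
    have "idem 2 {0} = (\<lambda>_. 1)"
      by (simp add: idem_def fun_eq_iff)
    then show ?thesis
      unfolding concentrated_iff True using \<gamma>1 by (intro exI[of _ "{0}"]) (auto simp: fun_eq_iff)
  next
    case False
    obtain m where m: "q = 2 * m + 1" "m \<ge> 1"
      using odd_prime_decomp[OF q False] by blast
    define H where "H = {0..<0 + int (m + 1)}"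
    define f where "f = idem q H"
    have q2: "q \<ge> 2" and H: "H \<subseteq> {0..<int q}" "H \<noteq> {}"
      using m by (auto simp: H_def)
    have f_1: "q / 6 \<le> cmod (f 1)"
    proof -
      have "pi / 6 = pi * (1 / 3) / 2" by simp
      also have "\<dots> \<le> (pi * m / q) / 2"
        using m by (simp add: field_simps)
      also have "\<dots> \<le> sin (pi * m / q)"
        by (rule sin_ge_half) (use m in \<open>auto simp: field_simps\<close>)
      also have "\<dots> = sin (pi - pi * (m + 1) / q)"
        using m by (simp add: field_simps)
      finally have "pi / 6 \<le> sin (pi * (m + 1) / q)"
        by simp
      moreover have "0 < sin (pi / q)" "sin (pi / q) \<le> pi / q"
        using sin_pi_div_pos[OF q2] sin_x_le_x[of "pi / q"] by auto
      moreover from calculation have "0 \<le> sin (pi * (m + 1) / q)"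
        using pi_gt_zero by linarith
      ultimately have "(pi / 6) / (pi / q) \<le> sin (pi * (m + 1) / q) / sin (pi / q)"
        by (intro frac_le) auto
      then show ?thesis
        using norm_Dirichlet_kernel_at_1[OF q2, of "m + 1" 0] m by (simp add: f_def idem_def H_def)
    qed
    have "f 0 = of_nat (m + 1)"
      by (simp add: f_def idem_0 H_def)
    then have f_0: "cmod (f 0) \<le> q"
      using m by (simp only: norm_of_nat)
    have f_k: "cmod (f (int k)) \<le> q / k" if k: "k \<in> {1..m}" for k
    proof -
      have "pi * (2 * k) \<le> pi * q"
        using k m by (intro mult_left_mono) auto
      then have "pi * k / q / 2 \<le> sin (pi * k / q)"
        using q2 by (intro sin_ge_half) (auto simp: field_simps)
      moreover have "k / q \<le> pi * k / q / 2"
        using mult_right_mono[OF pi_ge_two, of "real k"] q2 by (simp add: field_simps)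
      ultimately have "k / q \<le> \<bar>sin (pi * k / q)\<bar>"
        by linarith
      then have "cmod (f (int k)) * (k / q) \<le> cmod (f (int k)) * \<bar>sin (pi * k / q)\<bar>"
        by (intro mult_left_mono) auto
      also have "\<dots> \<le> 1"
        using norm_Dirichlet_kernel[of q "int k" 0 "m + 1"] by (simp add: f_def idem_def H_def)
      finally show ?thesis
        using k q2 by (simp add: field_simps)
    qed
    have "(\<Sum>k\<in>{0..<int q}. cmod (f k) powr p) = cmod (f 0) powr p + 2 * (\<Sum>k=1..m. cmod (f (int k)) powr p)"
      using q2 by (intro sum_periodic_even[OF _ _ m(1)]) (simp_all add: f_def idem_periodic norm_idem_minus)
    also have "\<dots> \<le> q powr p + 2 * (\<Sum>k=1..m. q powr p * real k powr - p)"
    proof (intro add_mono mult_left_mono sum_mono)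
      show "cmod (f 0) powr p \<le> q powr p"
        using f_0 p by (intro powr_mono2) auto
    next
      fix k assume k: "k \<in> {1..m}"
      have "cmod (f (int k)) powr p \<le> (q / k) powr p"
        using f_k[OF k] p by (intro powr_mono2) auto
      also have "\<dots> = q powr p * real k powr - p"
        by (simp add: powr_divide powr_minus_divide)
      finally show "cmod (f (int k)) powr p \<le> q powr p * real k powr - p" .
    qed auto
    also have "\<dots> \<le> q powr p * (1 + 2 * Z)"
    proof -
      have "(\<Sum>k=1..m. real k powr - p) \<le> Z"
        unfolding Z_def by (intro sum_le_suminf sm) auto
      then have "q powr p * (\<Sum>k=1..m. real k powr - p) \<le> q powr p * Z"
        by (intro mult_left_mono) auto
      then show ?thesis
        unfolding sum_distrib_left[symmetric] by (simp add: algebra_simps)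
    qed
    finally have "\<gamma> * (\<Sum>k\<in>{0..<int q}. cmod (f k) powr p) \<le> \<gamma> * (q powr p * (1 + 2 * Z))"
      using \<gamma>0 by (intro mult_left_mono) auto
    also have "\<dots> = 2 * (q / 6) powr p"
    proof -
      define W where "W = 1 + 2 * Z"
      have "W \<noteq> 0" using Z by (simp add: W_def)
      then show ?thesis
        unfolding \<gamma>_def W_def[symmetric] by (simp add: powr_divide)
    qed
    also have "\<dots> \<le> 2 * cmod (f 1) powr p"
      using f_1 p by (intro mult_left_mono powr_mono2) auto
    finally show ?thesis
      unfolding concentrated_iff f_def using H(1) idem_nonzero[OF H] by blast
  qed
  then show ?thesis
    unfolding uniform_concentration_def using \<gamma>0 by blast
qed

section \<open>The quadratic case\<close>

text \<open>
  Rotate the sum to a positive number. It becomes a sum of values \<open>cos (2 pi (h - y) / q)\<close>, and the \<open>n\<close>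
  largest of them belong to the \<open>n\<close> integers closest to \<open>y\<close>. To avoid sorting, all values are
  compared with the level \<open>\<tau>\<close> that separates these integers from the others.
\<close>

lemma norm_idem_at_1_le:
  assumes q: "q \<ge> 2" and H: "H \<subseteq> {0..<int q}" and n: "n = card H"
  shows "cmod (idem q H 1) \<le> sin (pi * n / q) / sin (pi / q)"
proof (cases "idem q H 1 = 0")
  case True
  have "n \<le> q"
    using card_mono[OF _ H] n by simp
  then have "sin (pi * n / q) \<ge> 0"
    using q by (intro sin_ge_zero) (auto simp: field_simps)
  then show ?thesis
    using True sin_pi_div_pos[OF q] by simp
next
  case False
  have fin: "finite H" using H finite_subset by blast
  have n_le: "n \<le> q"
    using card_mono[OF _ H] n by simp
  define \<phi> where "\<phi> = Arg (idem q H 1)"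
  \<comment> \<open>the angle of the rotation, in units of the spacing of the roots\<close>
  define y where "y = \<phi> * q / (2 * pi)"
  define \<psi> where "\<psi> h = cos (2 * pi * (of_int h - y) / q)" for h :: int
  define \<tau> where "\<tau> = cos (pi * n / q)"
  \<comment> \<open>the \<open>n\<close> integers closest to \<open>y\<close>, and a full period around \<open>y\<close> that contains them\<close>
  define a where "a = \<lceil>y - n / 2\<rceil>"
  define b where "b = \<lceil>y - q / 2\<rceil>"
  have y_eq: "2 * pi * y / q = \<phi>"
    using q by (simp add: y_def)
  have \<psi>_Re: "\<psi> h = Re (zq_char q h 1 * cis (- \<phi>))" for h
    by (simp add: \<psi>_def right_diff_distrib diff_divide_distrib y_eq zq_char_eq_cis cis_mult)
  have \<psi>_sum: "(\<Sum>h\<in>A. \<psi> h) = Re ((\<Sum>h\<in>A. zq_char q h 1) * cis (- \<phi>))" for A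
    by (simp add: \<psi>_Re sum_distrib_right del: times_complex.simps)
  have "idem q H 1 * cis (- \<phi>) = cmod (idem q H 1)"
    using rcis_cmod_Arg[of "idem q H 1"] unfolding \<phi>_def rcis_def
    by (metis cis_mult cis_zero diff_self mult.assoc mult.right_neutral diff_conv_add_uminus)
  then have norm_eq: "cmod (idem q H 1) = (\<Sum>h\<in>H. \<psi> h)"
    using \<psi>_sum[of H] by (simp add: idem_def)
  have \<psi>_cos: "\<psi> h = cos (2 * pi * \<bar>of_int h - y\<bar> / q)" for h
  proof -
    have "2 * pi * \<bar>of_int h - y\<bar> / q = \<bar>2 * pi * (of_int h - y) / q\<bar>"
      by (simp add: abs_mult)
    then show ?thesis
      by (simp only: \<psi>_def cos_abs_real)
  qed
  have \<psi>_ge: "\<tau> \<le> \<psi> h" if "\<bar>of_int h - y\<bar> \<le> n / 2" for h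
    unfolding \<psi>_cos \<tau>_def
    by (rule cos_monotone_0_pi_le) (use that n_le q in \<open>auto simp: field_simps\<close>)
  have \<psi>_le: "\<psi> h \<le> \<tau>" if "n / 2 \<le> \<bar>of_int h - y\<bar>" "\<bar>of_int h - y\<bar> \<le> q / 2" for h
    unfolding \<psi>_cos \<tau>_def
    by (rule cos_monotone_0_pi_le) (use that n_le q in \<open>auto simp: field_simps\<close>)
  have in_I: "h \<in> {a..<a + int n} \<longleftrightarrow> y - n / 2 \<le> of_int h \<and> of_int h < y + n / 2" for h
    unfolding a_def by (auto simp: ceiling_le_iff) linarith+
  have in_W: "h \<in> {b..<b + int q} \<longleftrightarrow> y - q / 2 \<le> of_int h \<and> of_int h < y + q / 2" for h
    unfolding b_def by (auto simp: ceiling_le_iff) linarith+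
  have I_W: "{a..<a + int n} \<subseteq> {b..<b + int q}"
    using in_I in_W n_le by (auto simp: subset_iff)
  have per: "\<psi> (h + int q) = \<psi> h" for h
  proof -
    have "2 * pi * (of_int (h + int q) - y) / q = 2 * pi * (of_int h - y) / q + 2 * pi"
      using q by (simp add: field_simps)
    then show ?thesis by (simp add: \<psi>_def)
  qed
  have "(\<Sum>h\<in>H. \<psi> h) - n * \<tau> = (\<Sum>h\<in>H. \<psi> h - \<tau>)"
    by (simp add: sum_subtractf n)
  also have "\<dots> \<le> (\<Sum>h\<in>H. max 0 (\<psi> h - \<tau>))"
    by (intro sum_mono) auto
  also have "\<dots> \<le> (\<Sum>h\<in>{0..<int q}. max 0 (\<psi> h - \<tau>))"
    by (intro sum_mono2 H) auto
  also have "\<dots> = (\<Sum>h\<in>{b..<b + int q}. max 0 (\<psi> h - \<tau>))"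
    by (rule sum_periodic_window[symmetric]) (simp add: per)
  also have "\<dots> = (\<Sum>h\<in>{a..<a + int n}. \<psi> h - \<tau>)"
  proof (rule sum.mono_neutral_cong_right[OF _ I_W])
    show "\<forall>h\<in>{b..<b + int q} - {a..<a + int n}. max 0 (\<psi> h - \<tau>) = 0"
    proof
      fix h assume "h \<in> {b..<b + int q} - {a..<a + int n}"
      then have "n / 2 \<le> \<bar>of_int h - y\<bar>" "\<bar>of_int h - y\<bar> \<le> q / 2"
        unfolding Diff_iff in_I in_W by auto
      then show "max 0 (\<psi> h - \<tau>) = 0"
        using \<psi>_le by fastforce
    qed
    show "max 0 (\<psi> h - \<tau>) = \<psi> h - \<tau>" if "h \<in> {a..<a + int n}" for h
    proof -
      have "\<bar>of_int h - y\<bar> \<le> n / 2"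
        using that unfolding in_I by linarith
      then show ?thesis
        using \<psi>_ge[of h] by simp
    qed
  qed auto
  also have "\<dots> = (\<Sum>h\<in>{a..<a + int n}. \<psi> h) - n * \<tau>"
    by (simp add: sum_subtractf)
  also have "(\<Sum>h\<in>{a..<a + int n}. \<psi> h) \<le> cmod ((\<Sum>h\<in>{a..<a + int n}. zq_char q h 1) * cis (- \<phi>))"
    unfolding \<psi>_sum by (rule complex_Re_le_cmod)
  also have "\<dots> = sin (pi * n / q) / sin (pi / q)"
    by (simp add: norm_mult norm_Dirichlet_kernel_at_1[OF q n_le])
  finally show ?thesis
    unfolding norm_eq by simp
qed

definition concentration_profile :: "real \<Rightarrow> real" where
  "concentration_profile x = 2 * (sin x)\<^sup>2 / (pi * x)"

text \<open>
  With \<open>x = pi n / q\<close> the quotient of \<open>2 |f 1|\<^sup>2\<close> and \<open>q n\<close> is the profile at \<open>x\<close>, up to a factor that does not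
  depend on \<open>n\<close> and tends to \<open>1\<close>.
\<close>

lemma gamma_sharp_q_2_le:
  assumes q: "q \<ge> 2" and \<sigma>: "\<And>x. x > 0 \<Longrightarrow> concentration_profile x \<le> \<sigma>"
  shows "gamma_sharp_q 2 q \<le> \<sigma> * (pi / (q * sin (pi / q)))\<^sup>2"
proof (rule gamma_sharp_q_le)
  fix H assume H: "H \<subseteq> {0..<int q}" "H \<noteq> {}"
  define n where "n = card H"
  define x where "x = pi * n / q"
  have "finite H" using H finite_subset by blast
  then have n0: "n > 0" using H by (simp add: n_def card_gt_0_iff)
  then have x0: "x > 0" using q by (simp add: x_def)
  have s0: "sin (pi / q) > 0" by (rule sin_pi_div_pos[OF q])
  have "2 * (cmod (idem q H 1))\<^sup>2 \<le> 2 * (sin x / sin (pi / q))\<^sup>2"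
    using norm_idem_at_1_le[OF q H(1) n_def] by (intro mult_left_mono power_mono) (auto simp: x_def)
  also have "\<dots> = concentration_profile x * (pi * x / (sin (pi / q))\<^sup>2)"
    using x0 by (simp add: concentration_profile_def power_divide)
  also have "\<dots> \<le> \<sigma> * (pi * x / (sin (pi / q))\<^sup>2)"
    using \<sigma>[OF x0] x0 by (intro mult_right_mono) auto
  also have "\<dots> = \<sigma> * (pi / (q * sin (pi / q)))\<^sup>2 * (q * real n)"
    using q s0 by (simp add: x_def power2_eq_square field_simps)
  finally show "2 * cmod (idem q H 1) powr 2
      \<le> \<sigma> * (pi / (q * sin (pi / q)))\<^sup>2 * (\<Sum>k\<in>{0..<int q}. cmod (idem q H k) powr 2)"
    using Parseval_set[OF _ H(1)] q by (simp add: idem_def n_def)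
qed (use q in auto)

lemma tendsto_sin_pi_div: "(\<lambda>q. q * sin (pi / real q)) \<longlonglongrightarrow> pi"
  by real_asymp

lemma tendsto_floor_proportion: "c \<ge> 0 \<Longrightarrow> (\<lambda>q. real (nat \<lfloor>c * real q\<rfloor>) / q) \<longlonglongrightarrow> c"
proof -
  assume c: "c \<ge> 0"
  have "(\<lambda>q. of_int \<lfloor>c * real q\<rfloor> / real q) \<longlonglongrightarrow> c"
    by real_asymp
  then show ?thesis using c by simp
qed

text \<open>
  Intervals filling the proportion \<open>x / pi\<close> of the residues, for \<open>q\<close> so large that they are not empty.
\<close>

lemma Dirichlet_kernel_proportion:
  assumes x: "0 < x" "x < pi" and n: "n = nat \<lfloor>x / pi * real q\<rfloor>" and q: "q \<ge> max 2 (nat \<lceil>pi / x\<rceil>)"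
  shows "0 < n" "n < q" "cmod (idem q {0..<int n} 1) = sin (pi * n / q) / sin (pi / q)"
proof -
  have q2: "q \<ge> 2" and q': "q \<ge> pi / x"
    using q by (auto simp: nat_le_iff ceiling_le_iff)
  have "1 \<le> x / pi * real q"
    using q' x by (simp add: field_simps)
  then show "0 < n"
    by (simp add: n)
  have "x / pi * real q < 1 * real q"
    using x q2 by (intro mult_strict_right_mono) auto
  then have "\<lfloor>x / pi * real q\<rfloor> < int q"
    by (simp add: floor_less_iff)
  then show "n < q"
    using q2 unfolding n by linarith
  then show "cmod (idem q {0..<int n} 1) = sin (pi * n / q) / sin (pi / q)"
    using norm_Dirichlet_kernel_at_1[of q n 0] q2 by (simp add: idem_def)
qed

lemma concentration_profile_le_gamma_sharp:
  assumes x: "0 < x" "x < pi"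
  shows "ereal (concentration_profile x) \<le> gamma_sharp 2"
proof (rule gamma_sharp_ge)
  define n where "n q = nat \<lfloor>x / pi * real q\<rfloor>" for q :: nat
  define r where "r q = 2 * (sin (pi * (n q / q)))\<^sup>2 / ((q * sin (pi / q))\<^sup>2 * (n q / q))" for q :: nat
  have "r \<longlonglongrightarrow> 2 * (sin (pi * (x / pi)))\<^sup>2 / (pi\<^sup>2 * (x / pi))"
    unfolding r_def n_def using x
    by (intro tendsto_intros tendsto_sin_pi_div tendsto_floor_proportion) auto
  then show "r \<longlonglongrightarrow> concentration_profile x"
    by (simp add: concentration_profile_def power2_eq_square)
  show "r q \<le> gamma_sharp_q 2 q" if q: "prime q" "q \<ge> max 2 (nat \<lceil>pi / x\<rceil>)" for q
  proof (rule gamma_sharp_q_ge)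
    note D = Dirichlet_kernel_proportion[OF x n_def q(2)]
    have q2: "q \<ge> 2" using q(2) by simp
    have eq: "r q * (real q * real (n q)) = 2 * (cmod (idem q {0..<int (n q)} 1))\<^sup>2"
      unfolding D(3) using D(1,2) q2 sin_pi_div_pos[OF q2] by (simp add: r_def power2_eq_square)
    show "{0..<int (n q)} \<subseteq> {0..<int q}" "{0..<int (n q)} \<noteq> {}"
      using D by auto
    then show "r q * (\<Sum>k\<in>{0..<int q}. cmod (idem q {0..<int (n q)} k) powr 2)
        \<le> 2 * cmod (idem q {0..<int (n q)} 1) powr 2"
      using Parseval_set[of q "{0..<int (n q)}"] q2 eq D(2) by (simp flip: idem_def)
  qed (use q in auto)
qed

lemma sin_Taylor_bound:
  fixes x :: real
  shows "\<bar>sin x - (x - x ^ 3 / 6 + x ^ 5 / 120 - x ^ 7 / 5040 + x ^ 9 / 362880)\<bar> \<le> \<bar>x\<bar> ^ 11 / 39916800"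
proof -
  have poly: "(\<Sum>m<11. sin_coeff m * x ^ m) = x - x ^ 3 / 6 + x ^ 5 / 120 - x ^ 7 / 5040 + x ^ 9 / 362880"
    by (simp add: sin_coeff_def lessThan_nat_numeral fact_numeral)
  have err: "inverse (fact 11) * \<bar>x\<bar> ^ 11 = \<bar>x\<bar> ^ 11 / 39916800"
    by (simp add: fact_numeral)
  show ?thesis
    using Maclaurin_sin_bound[of x 11] unfolding poly err .
qed

lemma sin_1_1656_ge: "sin 1.1656 \<ge> (0.9190245 :: real)"
  using sin_Taylor_bound[of "1.1656"] unfolding abs_le_iff by (simp add: power_divide)

text \<open>
  The profile is maximal at the solution of \<open>tan x = 2 x\<close>, which is \<open>1.16556\<dots>\<close>. The maximum exceeds the
  bound by less than \<open>0.000002\<close>, which dictates the precision of the sine.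
\<close>

lemma concentration_profile_ge: "0.4613 \<le> concentration_profile 1.1656"
proof -
  have "0.4613 * (pi * 1.1656) \<le> 0.4613 * (3.1415927 * 1.1656)"
    using pi_bounds by (intro mult_left_mono mult_right_mono) auto
  also have "\<dots> \<le> 2 * (0.9190245 * 0.9190245 :: real)"
    by simp
  also have "\<dots> \<le> 2 * (sin 1.1656 * sin 1.1656)"
    using sin_1_1656_ge by (intro mult_left_mono mult_mono) auto
  finally show ?thesis
    by (simp add: concentration_profile_def power2_eq_square field_simps)
qed

text \<open>
  The line \<open>0.72465 y\<close> passes just above \<open>1 - cos y\<close> near \<open>y = 2.331\<close>. Below \<open>1.4493 = 2 \<cdot> 0.72465\<close> the bound
  \<open>y\<^sup>2 / 2\<close> is enough, above \<open>2.76\<close> the bound \<open>2\<close>. In between the cosine is expanded around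
  \<open>3 pi / 4 = 2.356\<dots>\<close>, a point near the critical one where its value is known.
\<close>

lemma one_minus_cos_le:
  fixes y :: real
  assumes "y > 0"
  shows "1 - cos y \<le> 0.72465 * y"
proof -
  consider "y \<le> 1.4493" | "2.76 \<le> y" | "1.4493 \<le> y" "y \<le> 2.76"
    by linarith
  then show ?thesis
  proof cases
    case 1
    have "(sin (y / 2))\<^sup>2 \<le> (y / 2)\<^sup>2"
      using abs_sin_x_le_abs_x[of "y / 2"] by (rule iffD1[OF abs_le_square_iff])
    then have "1 - cos y \<le> y * y / 2"
      using cos_double_sin[of "y / 2"] by (simp add: power2_eq_square)
    also have "\<dots> \<le> 0.72465 * y"
      using 1 assms by simp
    finally show ?thesis .
  next
    case 2
    then have "2 \<le> 0.72465 * y" by simp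
    then show ?thesis using cos_ge_minus_one[of y] by linarith
  next
    case 3
    define r where "r = sqrt 2 / 2"
    define t where "t = 3 * pi / 4 - y"
    have r: "0.7071067 \<le> r" "r \<le> 0.7071069"
    proof -
      have "1.4142134 \<le> sqrt 2"
        by (rule real_le_rsqrt) (simp add: power2_eq_square)
      moreover have "sqrt 2 \<le> 1.4142138"
        by (rule real_le_lsqrt) (simp_all add: power2_eq_square)
      ultimately show "0.7071067 \<le> r" "r \<le> 0.7071069"
        by (simp_all add: r_def)
    qed
    have t: "-0.41 \<le> t" "t \<le> 0.91"
      using 3 pi_bounds unfolding t_def by simp_all
    have "y = pi - (pi / 4 + t)"
      by (simp add: t_def)
    then have "cos y = - cos (pi / 4 + t)"
      by (simp only: cos_pi_minus)
    also have "\<dots> = r * (sin t - cos t)"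
      by (simp add: cos_add cos_45 sin_45 r_def algebra_simps)
    finally have cos_y: "cos y = r * (sin t - cos t)" .
    have "\<bar>sin t - (t - t ^ 3 / 6)\<bar> \<le> t ^ 4 / 24"
      using Maclaurin_sin_bound[of t 4]
      by (simp add: sin_coeff_def fact_numeral lessThan_nat_numeral)
    then have sin_t: "t - t ^ 3 / 6 - t ^ 4 / 24 \<le> sin t"
      by linarith
    have cos_t: "cos t \<le> 1 - t ^ 2 / 2 + t ^ 4 / 24"
    proof -
      obtain s where s: "cos t = (\<Sum>m<4. cos_coeff m * t ^ m) + cos (s + 1 / 2 * real 4 * pi) / fact 4 * t ^ 4"
        using Maclaurin_cos_expansion[of t 4] by blast
      have "cos (s + 1 / 2 * real 4 * pi) / fact 4 * t ^ 4 \<le> 1 / fact 4 * t ^ 4"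
        by (intro mult_right_mono divide_right_mono) auto
      moreover have "(\<Sum>m<4. cos_coeff m * t ^ m) = 1 - t ^ 2 / 2"
        by (simp add: cos_coeff_def lessThan_nat_numeral fact_numeral)
      ultimately show ?thesis
        unfolding s by (simp add: fact_numeral)
    qed
    have "cos t - sin t \<le> (1 - t ^ 2 / 2 + t ^ 4 / 24) - (t - t ^ 3 / 6 - t ^ 4 / 24)"
      using sin_t cos_t by linarith
    then have "r * (cos t - sin t) \<le> r * (1 - t - t\<^sup>2 * (1 / 2 - t / 6 - t\<^sup>2 / 12))"
      using r by (intro mult_left_mono) (auto simp: algebra_simps power2_eq_square eval_nat_numeral)
    also have "\<dots> \<le> 0.72465 * (3 * pi / 4) - 1 - 0.72465 * t"
    proof -
      have lin: "r * (1 - t) \<le> 0.7071069 * (1 - t)"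
        using r t by (intro mult_right_mono) auto
      \<comment> \<open>\<open>0.0175431\<close> is \<open>0.72465 - 0.7071069\<close>, and \<open>0.0003094\<close> is \<open>0.72465 (3 pi / 4) - 1.7071069\<close> rounded down\<close>
      have "0.0175431 * t \<le> 0.0003094 + 0.7071067 * (t\<^sup>2 * (1 / 2 - t / 6 - t\<^sup>2 / 12))"
      proof (cases "t \<le> 0.3")
        case True
        have "\<bar>t\<bar> * \<bar>t\<bar> \<le> 0.41 * 0.41"
          using t True by (intro mult_mono) auto
        then have t2: "t\<^sup>2 \<le> 0.1681"
          by (simp add: power2_eq_square)
        have "t\<^sup>2 \<le> 0.09 \<or> t \<le> 0"
        proof (cases "t \<ge> 0")
          case pos: True
          have "t * t \<le> 0.3 * 0.3"
            using pos True by (intro mult_mono) auto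
          then show ?thesis by (simp add: power2_eq_square)
        qed auto
        then have "0.4425 \<le> 1 / 2 - t / 6 - t\<^sup>2 / 12"
          using True t2 by auto
        then have "t\<^sup>2 * 0.4425 \<le> t\<^sup>2 * (1 / 2 - t / 6 - t\<^sup>2 / 12)"
          by (intro mult_left_mono) auto
        \<comment> \<open>\<open>0.3129 t\<^sup>2 - 0.0175431 t\<close> is minimal near \<open>t = 0.028\<close>\<close>
        moreover have "0 \<le> (t - 0.028)\<^sup>2"
          by simp
        ultimately show ?thesis
          using True by (simp add: power2_diff power_divide)
      next
        case False
        have "t * t \<le> 0.91 * 0.91"
          using t False by (intro mult_mono) auto
        then have "0.27 \<le> 1 / 2 - t / 6 - t\<^sup>2 / 12"
          using t by (simp add: power2_eq_square)
        then have "t * 0.3 * 0.27 \<le> t * t * (1 / 2 - t / 6 - t\<^sup>2 / 12)"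
          using False by (intro mult_mono) auto
        then have "0.081 * t \<le> t\<^sup>2 * (1 / 2 - t / 6 - t\<^sup>2 / 12)"
          by (simp only: power2_eq_square) simp
        then have "0.7071067 * (0.081 * t) \<le> 0.7071067 * (t\<^sup>2 * (1 / 2 - t / 6 - t\<^sup>2 / 12))"
          by (intro mult_left_mono) auto
        moreover have "0.0175431 * t \<le> 0.0003094 + 0.7071067 * (0.081 * t)"
          using False by simp
        ultimately show ?thesis
          by linarith
      qed
      moreover have "0 \<le> t\<^sup>2 * (1 / 2 - t / 6 - t\<^sup>2 / 12)"
      proof (intro mult_nonneg_nonneg)
        have "\<bar>t\<bar> * \<bar>t\<bar> \<le> 1 * 1"
          using t by (intro mult_mono) auto
        then show "0 \<le> 1 / 2 - t / 6 - t\<^sup>2 / 12"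
          using t by (simp add: power2_eq_square)
      qed auto
      then have "0.7071067 * (t\<^sup>2 * (1 / 2 - t / 6 - t\<^sup>2 / 12)) \<le> r * (t\<^sup>2 * (1 / 2 - t / 6 - t\<^sup>2 / 12))"
        using r by (intro mult_right_mono) auto
      ultimately have "r * (1 - t) - r * (t\<^sup>2 * (1 / 2 - t / 6 - t\<^sup>2 / 12))
          \<le> 0.7071069 * (1 - t) + 0.0003094 - 0.0175431 * t"
        using lin by linarith
      also have "\<dots> = 0.7074163 - 0.72465 * t"
        by (simp add: field_simps)
      also have "\<dots> \<le> 0.72465 * (3 * pi / 4) - 1 - 0.72465 * t"
        using pi_bounds by simp
      finally show ?thesis
        by (simp add: right_diff_distrib)
    qed
    finally have "r * (cos t - sin t) \<le> 0.72465 * (3 * pi / 4) - 1 - 0.72465 * t" .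
    moreover have "1 - cos y = 1 + r * (cos t - sin t)"
      by (simp add: cos_y algebra_simps)
    moreover have "0.72465 * y = 0.72465 * (3 * pi / 4) - 0.72465 * t"
    proof -
      have "y = 3 * pi / 4 - t"
        by (simp add: t_def)
      then show ?thesis
        by (simp only: right_diff_distrib)
    qed
    ultimately show ?thesis
      by linarith
  qed
qed

lemma concentration_profile_le:
  assumes "x > 0"
  shows "concentration_profile x \<le> 0.46135"
proof -
  have "2 * (sin x)\<^sup>2 = 1 - cos (2 * x)"
    by (simp add: cos_double_sin)
  also have "\<dots> \<le> 0.72465 * (2 * x)"
    using assms by (intro one_minus_cos_le) simp
  also have "\<dots> \<le> 0.46135 * (pi * x)"
    using pi_bounds assms by simp
  finally show ?thesis
    using assms by (simp add: concentration_profile_def field_simps)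
qed

lemma concentration_profile_beyond_pi:
  assumes "pi \<le> x"
  shows "concentration_profile x \<le> 0.4613"
proof -
  have "2 * (sin x)\<^sup>2 \<le> 2"
    using abs_sin_le_one[of x] by (simp add: abs_square_le_1)
  also have "(2 :: real) \<le> 0.4613 * (3.14 * 3.14)"
    by simp
  also have "\<dots> \<le> 0.4613 * (pi * x)"
    using pi_bounds assms by (intro mult_left_mono mult_mono) auto
  finally have "2 * (sin x)\<^sup>2 \<le> 0.4613 * (pi * x)" .
  moreover have "0 < pi * x"
    using assms pi_gt_zero by (intro mult_pos_pos) linarith+
  ultimately show ?thesis
    by (simp only: concentration_profile_def pos_divide_le_eq)
qed

text \<open>
  From \<open>pi\<close> on the profile is below its value at \<open>1.1656\<close>, so that intervals, whose angles are below
  \<open>pi\<close>, realise the whole supremum.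
\<close>

theorem gamma_sharp_2:
  shows "gamma_sharp 2 = (SUP x\<in>{0<..}. ereal (2 * (sin x)\<^sup>2 / (pi * x)))"
    and "ereal 0.4613 \<le> gamma_sharp 2" and "gamma_sharp 2 < ereal 0.4614"
proof -
  define S where "S = (SUP x\<in>{0<..}. ereal (concentration_profile x))"
  have lower: "ereal (concentration_profile x) \<le> gamma_sharp 2" if "x > 0" "x < pi" for x
    using that by (rule concentration_profile_le_gamma_sharp)
  have "ereal 0.4613 \<le> ereal (concentration_profile 1.1656)"
    using concentration_profile_ge by simp
  also have "\<dots> \<le> gamma_sharp 2"
    using pi_bounds by (intro lower) auto
  finally show ge: "ereal 0.4613 \<le> gamma_sharp 2" .
  have "S \<le> gamma_sharp 2"
    unfolding S_def
  proof (rule SUP_least)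
    fix x :: real assume "x \<in> {0<..}"
    then show "ereal (concentration_profile x) \<le> gamma_sharp 2"
      using lower[of x] order_trans[OF _ ge, of "ereal (concentration_profile x)"]
        concentration_profile_beyond_pi[of x]
      by (cases "x < pi") auto
  qed
  moreover have S_le: "S \<le> ereal 0.46135"
    unfolding S_def by (intro SUP_least) (use concentration_profile_le in auto)
  moreover have "gamma_sharp 2 \<le> S"
  proof -
    have le_S: "ereal (concentration_profile x) \<le> S" if "x > 0" for x
      unfolding S_def by (rule SUP_upper) (use that in auto)
    then have "ereal (concentration_profile 1) \<le> S"
      by simp
    then obtain \<sigma> where \<sigma>: "S = ereal \<sigma>"
      using S_le by (cases S) auto
    have "(\<lambda>q. \<sigma> * (pi / (q * sin (pi / real q)))\<^sup>2) \<longlonglongrightarrow> \<sigma> * (pi / pi)\<^sup>2"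
      by (intro tendsto_intros tendsto_sin_pi_div) auto
    then have "(\<lambda>q. \<sigma> * (pi / (q * sin (pi / real q)))\<^sup>2) \<longlonglongrightarrow> \<sigma>"
      by simp
    then show ?thesis
      unfolding \<sigma> using le_S by (intro gamma_sharp_le[where N = 2, OF gamma_sharp_q_2_le]) (auto simp: \<sigma>)
  qed
  ultimately show "gamma_sharp 2 = (SUP x\<in>{0<..}. ereal (2 * (sin x)\<^sup>2 / (pi * x)))"
    by (simp add: S_def concentration_profile_def)
  have "gamma_sharp 2 \<le> ereal 0.46135"
    using \<open>gamma_sharp 2 \<le> S\<close> S_le by (rule order_trans)
  also have "\<dots> < ereal 0.4614"
    by simp
  finally show "gamma_sharp 2 < ereal 0.4614" .
qed

section \<open>The fourth power\<close>

text \<open>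
  The map \<open>\<phi>\<close> selects the representative of a difference: reduction modulo \<open>q\<close> for arbitrary sets, the
  identity for short intervals, where differences do not wrap around.
\<close>

definition difference_count :: "(int \<Rightarrow> int) \<Rightarrow> int set \<Rightarrow> int \<Rightarrow> nat" where
  "difference_count \<phi> H m = card {z \<in> H \<times> H. \<phi> (fst z - snd z) = m}"

lemma norm_idem_squared:
  assumes "finite H" "finite S" and range: "\<And>a b. a \<in> H \<Longrightarrow> b \<in> H \<Longrightarrow> \<phi> (a - b) \<in> S"
    and \<phi>: "\<And>d. zq_char q (\<phi> d) k = zq_char q d k"
  shows "of_real ((cmod (idem q H k))\<^sup>2) = (\<Sum>m\<in>S. of_nat (difference_count \<phi> H m) * zq_char q m k)"
proof -
  have "of_real ((cmod (idem q H k))\<^sup>2) = (\<Sum>a\<in>H. \<Sum>b\<in>H. zq_char q (a - b) k)"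
    unfolding complex_norm_square by (simp add: idem_def sum_product zq_char_diff_left)
  also have "\<dots> = (\<Sum>z\<in>H \<times> H. zq_char q (\<phi> (fst z - snd z)) k)"
    by (simp add: sum.cartesian_product \<phi> case_prod_unfold)
  also have "\<dots> = (\<Sum>m\<in>S. \<Sum>z\<in>{z \<in> H \<times> H. \<phi> (fst z - snd z) = m}. zq_char q (\<phi> (fst z - snd z)) k)"
    using assms by (intro sum.group[symmetric]) auto
  also have "\<dots> = (\<Sum>m\<in>S. of_nat (difference_count \<phi> H m) * zq_char q m k)"
    by (simp add: difference_count_def)
  finally show ?thesis .
qed

lemma sum_idem_fourth_power:
  assumes "q > 0" "finite H" and S: "S \<subseteq> {a..<a + int q}"
    and range: "\<And>a b. a \<in> H \<Longrightarrow> b \<in> H \<Longrightarrow> \<phi> (a - b) \<in> S"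
    and \<phi>: "\<And>d k. zq_char q (\<phi> d) k = zq_char q d k"
  shows "(\<Sum>k\<in>{0..<int q}. cmod (idem q H k) ^ 4) = q * (\<Sum>m\<in>S. (real (difference_count \<phi> H m))\<^sup>2)"
proof -
  have fin: "finite S" using S finite_subset by blast
  have "cmod (idem q H k) ^ 4 = (cmod (\<Sum>m\<in>S. of_nat (difference_count \<phi> H m) * zq_char q m k))\<^sup>2" for k
  proof -
    have "cmod (idem q H k) ^ 4 = (cmod (of_real ((cmod (idem q H k))\<^sup>2)))\<^sup>2"
      by (simp add: norm_power)
    then show ?thesis
      by (simp only: norm_idem_squared[OF assms(2) fin range \<phi>])
  qed
  then show ?thesis
    using Parseval_window[OF assms(1) S, of "\<lambda>m. of_nat (difference_count \<phi> H m)"] by simp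
qed

text \<open>
  The sum telescopes after multiplication by \<open>2 sin \<theta>\<close>, and the last angle \<open>(2 J + 1) \<theta>\<close> differs from \<open>pi\<close>
  by \<open>pi / q\<close> only, half of \<open>\<theta>\<close>.
\<close>

lemma sum_cos_le:
  assumes "q = 4 * J + 1 \<or> q = 4 * J + 3" and q: "q \<ge> 3"
  shows "(\<Sum>j=1..J. cos (4 * pi * real j / real q)) \<le> 0"
proof -
  define \<theta> where "\<theta> = 2 * pi / real q"
  have tele: "2 * sin \<theta> * (\<Sum>j=1..n. cos (2 * real j * \<theta>)) = sin ((2 * real n + 1) * \<theta>) - sin \<theta>" for n
  proof (induction n)
    case (Suc n)
    have "sin ((2 * real (Suc n) + 1) * \<theta>) - sin ((2 * real n + 1) * \<theta>) = 2 * sin \<theta> * cos (2 * real (Suc n) * \<theta>)"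
      using sin_diff_sin[of "(2 * real (Suc n) + 1) * \<theta>" "(2 * real n + 1) * \<theta>"]
      by (simp add: algebra_simps add_divide_distrib)
    then show ?case
      using Suc by (simp add: distrib_left)
  qed simp
  have \<theta>: "0 < \<theta>" "\<theta> < pi"
    using q pi_gt_zero by (auto simp: \<theta>_def field_simps)
  have "sin ((2 * real J + 1) * \<theta>) \<le> sin \<theta>"
    using assms(1)
  proof
    assume q1: "q = 4 * J + 1"
    have "(2 * real J + 1) * \<theta> = pi + pi / q"
      unfolding \<theta>_def q1 by (simp add: field_simps)
    then have "sin ((2 * real J + 1) * \<theta>) = - sin (pi / q)"
      by (simp only: sin_periodic_pi2)
    moreover have "sin (pi / q) > 0"
      using q by (intro sin_pi_div_pos) auto
    moreover have "sin \<theta> > 0"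
      using \<theta> by (rule sin_gt_zero)
    ultimately show ?thesis by linarith
  next
    assume q3: "q = 4 * J + 3"
    have "(2 * real J + 1) * \<theta> = pi - pi / q"
      unfolding \<theta>_def q3 by (simp add: field_simps)
    then have eq: "sin ((2 * real J + 1) * \<theta>) = sin (pi / q)"
      by (simp only: sin_pi_minus)
    also have "\<dots> \<le> sin \<theta>"
    proof -
      have "0 \<le> sin (pi / q)" "0 \<le> 2 * cos (pi / q) - 1"
      proof -
        show "0 \<le> sin (pi / q)"
          using sin_pi_div_pos[of q] q by simp
        have "cos (pi / 3) \<le> cos (pi / q)"
          using q by (intro cos_monotone_0_pi_le) (auto simp: field_simps)
        then show "0 \<le> 2 * cos (pi / q) - 1"
          by (simp add: cos_60)
      qed
      then have "0 \<le> sin (pi / q) * (2 * cos (pi / q) - 1)"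
        by (rule mult_nonneg_nonneg)
      moreover have "sin \<theta> = 2 * sin (pi / q) * cos (pi / q)"
        using sin_double[of "pi / q"] by (simp add: \<theta>_def)
      ultimately show ?thesis
        by (simp add: algebra_simps)
    qed
    finally show ?thesis .
  qed
  then have "2 * sin \<theta> * (\<Sum>j=1..J. cos (2 * real j * \<theta>)) \<le> 0"
    unfolding tele by simp
  moreover have "sin \<theta> > 0"
    using \<theta> by (rule sin_gt_zero)
  ultimately have "(\<Sum>j=1..J. cos (2 * real j * \<theta>)) \<le> 0"
    by (simp add: mult_le_0_iff)
  then show ?thesis
    by (simp add: \<theta>_def mult_ac)
qed

text \<open>
  The mean of the squared positive part over the circle is one quarter. With \<open>cos\<^sup>2 \<alpha> = (1 + cos 2\<alpha>) / 2\<close>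
  the sum over \<open>q\<close> equidistant points exceeds \<open>q / 4\<close> at most by the contribution of \<open>0\<close>.
\<close>

lemma sum_positive_part_cos_squared_le:
  assumes q: "odd q" "q \<ge> 3"
  shows "(\<Sum>m\<in>{0..<int q}. (max 0 (cos (2 * pi * of_int m / q)))\<^sup>2) \<le> q / 4 + 1"
proof -
  obtain M where M: "q = 2 * M + 1"
    using q(1) by (elim oddE)
  define J where "J = q div 4"
  have J: "q = 4 * J + 1 \<or> q = 4 * J + 3"
    using q(1) unfolding J_def by presburger
  have JM: "J \<le> M" using M J by auto
  define g where "g m = (max 0 (cos (2 * pi * of_int m / q)))\<^sup>2" for m :: int
  have per: "g (m + int q) = g m" for m
  proof -
    have "2 * pi * of_int (m + int q) / q = 2 * pi * of_int m / q + 2 * pi"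
      using q by (simp add: field_simps)
    then show ?thesis by (simp add: g_def)
  qed
  have even: "g (- m) = g m" for m
    by (simp add: g_def)
  have "sum g {0..<int q} = g 0 + 2 * (\<Sum>j=1..M. g (int j))"
    by (rule sum_periodic_even[OF per even M])
  also have "(\<Sum>j=1..M. g (int j)) = (\<Sum>j=1..J. g (int j))"
  proof (rule sum.mono_neutral_right)
    show "\<forall>j\<in>{1..M} - {1..J}. g (int j) = 0"
    proof
      fix j assume j: "j \<in> {1..M} - {1..J}"
      then have "4 * j \<ge> q" "2 * j \<le> q"
        using J M by auto
      then have "pi / 2 \<le> 2 * pi * j / q" "2 * pi * j / q \<le> pi"
      proof -
        have "pi * q \<le> pi * (4 * j)" "pi * (2 * j) \<le> pi * q"
          using \<open>4 * j \<ge> q\<close> \<open>2 * j \<le> q\<close> by (intro mult_left_mono; simp)+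
        then show "pi / 2 \<le> 2 * pi * j / q" "2 * pi * j / q \<le> pi"
          using q by (auto simp: field_simps)
      qed
      then have "cos (2 * pi * j / q) \<le> cos (pi / 2)"
        by (intro cos_monotone_0_pi_le) auto
      then show "g (int j) = 0"
        by (simp add: g_def)
    qed
  qed (use JM in auto)
  also have "2 * (\<Sum>j=1..J. g (int j)) \<le> 2 * (\<Sum>j=1..J. (1 + cos (4 * pi * real j / real q)) / 2)"
  proof (intro mult_left_mono sum_mono)
    fix j
    have "g (int j) \<le> (cos (2 * pi * j / q))\<^sup>2"
      by (auto simp: g_def max_def)
    also have "\<dots> = (1 + cos (2 * (2 * pi * j / q))) / 2"
      unfolding cos_double_cos by simp
    finally show "g (int j) \<le> (1 + cos (4 * pi * real j / real q)) / 2"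
      by (simp add: mult.assoc)
  qed auto
  also have "\<dots> = J + (\<Sum>j=1..J. cos (4 * pi * real j / real q))"
    by (simp add: sum.distrib sum_divide_distrib[symmetric])
  also have "\<dots> \<le> J"
    using sum_cos_le[OF J q(2)] by simp
  also have "g 0 + J \<le> q / 4 + 1"
    using J by (auto simp: g_def)
  finally show ?thesis
    by (simp add: g_def)
qed

text \<open>
  Since the difference counts are nonnegative, discarding the negative values of the cosine before
  applying Cauchy-Schwarz is allowed; this gains the factor two over the trivial bound.
\<close>

lemma gamma_sharp_q_4_le:
  assumes q: "odd q" "q \<ge> 3"
  shows "gamma_sharp_q 4 q \<le> 2 * (1 / 4 + 1 / q)"
proof (rule gamma_sharp_q_le)
  fix H assume H: "H \<subseteq> {0..<int q}" "H \<noteq> {}"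
  have fin: "finite H" using H finite_subset by blast
  define c where "c m = real (difference_count (\<lambda>d. d mod int q) H m)" for m
  define w where "w m = max 0 (cos (2 * pi * of_int m / q))" for m :: int
  have "(cmod (idem q H 1))\<^sup>2 = Re (of_real ((cmod (idem q H 1))\<^sup>2))"
    by simp
  also have "of_real ((cmod (idem q H 1))\<^sup>2) = (\<Sum>m\<in>{0..<int q}. of_nat (difference_count (\<lambda>d. d mod int q) H m) * zq_char q m 1)"
    using q by (intro norm_idem_squared fin) (auto simp: zq_char_mod)
  also have "Re \<dots> = (\<Sum>m\<in>{0..<int q}. c m * cos (2 * pi * of_int m / q))"
    by (simp add: c_def zq_char_eq_cis)
  also have "\<dots> \<le> (\<Sum>m\<in>{0..<int q}. c m * w m)"
    by (intro sum_mono mult_left_mono) (auto simp: c_def w_def)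
  finally have "((cmod (idem q H 1))\<^sup>2)\<^sup>2 \<le> (\<Sum>m\<in>{0..<int q}. c m * w m)\<^sup>2"
    by (intro power_mono) auto
  also have "\<dots> \<le> (\<Sum>m\<in>{0..<int q}. (c m)\<^sup>2) * (\<Sum>m\<in>{0..<int q}. (w m)\<^sup>2)"
    by (rule Cauchy_Schwarz_ineq_sum)
  also have "\<dots> \<le> (\<Sum>m\<in>{0..<int q}. (c m)\<^sup>2) * (q / 4 + 1)"
    unfolding w_def by (intro mult_left_mono sum_positive_part_cos_squared_le q sum_nonneg) auto
  also have "\<dots> = (1 / 4 + 1 / q) * (q * (\<Sum>m\<in>{0..<int q}. (c m)\<^sup>2))"
    using q by (simp add: field_simps)
  also have "q * (\<Sum>m\<in>{0..<int q}. (c m)\<^sup>2) = (\<Sum>k\<in>{0..<int q}. cmod (idem q H k) ^ 4)"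
    unfolding c_def using q
    by (intro sum_idem_fourth_power[where a = 0, symmetric] fin) (auto simp: zq_char_mod)
  finally have "cmod (idem q H 1) ^ 4 \<le> (1 / 4 + 1 / q) * (\<Sum>k\<in>{0..<int q}. cmod (idem q H k) ^ 4)"
    by (simp flip: power_mult)
  then have "2 * cmod (idem q H 1) ^ 4 \<le> 2 * (1 / 4 + 1 / q) * (\<Sum>k\<in>{0..<int q}. cmod (idem q H k) ^ 4)"
    unfolding mult.assoc by (rule mult_left_mono) simp
  then show "2 * cmod (idem q H 1) powr 4 \<le> 2 * (1 / 4 + 1 / q) * (\<Sum>k\<in>{0..<int q}. cmod (idem q H k) powr 4)"
    by simp
qed (use q in auto)

lemma gamma_sharp_4_le: "gamma_sharp 4 \<le> ereal (1 / 2)"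
proof (rule gamma_sharp_le)
  show "gamma_sharp_q 4 q \<le> 2 * (1 / 4 + 1 / q)" if "prime q" "q \<ge> 3" for q
    using that prime_odd_nat[of q] by (intro gamma_sharp_q_4_le) auto
  show "(\<lambda>q. 2 * (1 / 4 + 1 / real q)) \<longlonglongrightarrow> 1 / 2"
    by real_asymp
qed

lemma difference_count_interval_le:
  "difference_count id {0..<int n} m \<le> nat (int n - \<bar>m\<bar>)"
proof -
  have "{z \<in> {0..<int n} \<times> {0..<int n}. id (fst z - snd z) = m} \<subseteq> (\<lambda>a. (a, a - m)) ` {max 0 m..<min (int n) (int n + m)}"
    by (auto simp: image_iff)
  then have "difference_count id {0..<int n} m \<le> card ((\<lambda>a. (a, a - m)) ` {max 0 m..<min (int n) (int n + m)})"
    unfolding difference_count_def by (intro card_mono) auto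
  also have "\<dots> \<le> card {max 0 m..<min (int n) (int n + m)}"
    by (rule card_image_le) auto
  also have "\<dots> = nat (int n - \<bar>m\<bar>)"
    by auto
  finally show ?thesis .
qed

lemma sum_squares_nat: "(\<Sum>j=1..m. (real j)\<^sup>2) = real m * (m + 1) * (2 * m + 1) / 6"
  by (induction m) (auto simp: field_simps power2_eq_square)

text \<open>
  The difference \<open>m\<close> occurs \<open>n - |m|\<close> times in an interval of length \<open>n\<close>. Since \<open>2 n \<le> q\<close>, distinct differences
  stay distinct modulo \<open>q\<close>.
\<close>

lemma Dirichlet_kernel_fourth_power_le:
  assumes "0 < n" "2 * n \<le> q"
  shows "(\<Sum>k\<in>{0..<int q}. cmod (idem q {0..<int n} k) ^ 4) \<le> q * ((2 * real n ^ 3 + n) / 3)"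
proof -
  obtain m where m: "n = Suc m"
    using assms(1) by (cases n) auto
  define S where "S = {- int m..int m}"
  define g where "g d = (real n - \<bar>of_int d\<bar>)\<^sup>2" for d :: int
  have "(\<Sum>k\<in>{0..<int q}. cmod (idem q {0..<int n} k) ^ 4) = q * (\<Sum>d\<in>S. (real (difference_count id {0..<int n} d))\<^sup>2)"
    using assms by (intro sum_idem_fourth_power[where a = "- int m"]) (auto simp: S_def m)
  also have "\<dots> \<le> q * (\<Sum>d\<in>S. g d)"
  proof (intro mult_left_mono sum_mono)
    fix d assume "d \<in> S"
    then have "\<bar>d\<bar> \<le> int n"
      by (auto simp: S_def m)
    have "real (difference_count id {0..<int n} d) \<le> real (nat (int n - \<bar>d\<bar>))"
      using difference_count_interval_le by (simp only: of_nat_le_iff)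
    also have "\<dots> = real n - \<bar>of_int d\<bar>"
      using \<open>\<bar>d\<bar> \<le> int n\<close> by simp
    finally show "(real (difference_count id {0..<int n} d))\<^sup>2 \<le> g d"
      unfolding g_def by (intro power_mono) auto
  qed auto
  also have "(\<Sum>d\<in>S. g d) = g 0 + 2 * (\<Sum>j=1..m. g (int j))"
    unfolding S_def by (rule sum_symmetric_interval) (simp add: g_def)
  also have "(\<Sum>j=1..m. g (int j)) = (\<Sum>j=1..m. (real j)\<^sup>2)"
    by (rule sum.reindex_bij_witness[of _ "\<lambda>j. n - j" "\<lambda>j. n - j"]) (auto simp: g_def m of_nat_diff)
  also have "g 0 + 2 * (\<Sum>j=1..m. (real j)\<^sup>2) = (2 * real n ^ 3 + n) / 3"
    unfolding sum_squares_nat by (simp add: g_def m power2_eq_square power3_eq_cube field_simps)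
  finally show ?thesis .
qed

lemma gamma_sharp_4_ge:
  assumes x: "0 < x" "x < pi / 2"
  shows "ereal (3 * sin x ^ 4 / (pi * x ^ 3)) \<le> gamma_sharp 4"
proof (rule gamma_sharp_ge)
  define n where "n q = nat \<lfloor>x / pi * real q\<rfloor>" for q :: nat
  define r where "r q = 2 * sin (pi * (n q / q)) ^ 4 * 3 /
      ((q * sin (pi / q)) ^ 4 * (2 * (n q / q) ^ 3 + (n q / q) * (1 / q)\<^sup>2))" for q :: nat
  have "(\<lambda>q. 1 / real q) \<longlonglongrightarrow> 0"
    by real_asymp
  then have "r \<longlonglongrightarrow> 2 * sin (pi * (x / pi)) ^ 4 * 3 / (pi ^ 4 * (2 * (x / pi) ^ 3 + (x / pi) * 0\<^sup>2))"
    unfolding r_def n_def using x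
    by (intro tendsto_intros tendsto_sin_pi_div tendsto_floor_proportion) auto
  then show "r \<longlonglongrightarrow> 3 * sin x ^ 4 / (pi * x ^ 3)"
    by (simp add: eval_nat_numeral field_simps)
  show "r q \<le> gamma_sharp_q 4 q" if q: "prime q" "q \<ge> max 2 (nat \<lceil>pi / x\<rceil>)" for q
  proof (rule gamma_sharp_q_ge)
    have x': "x < pi" using x by simp
    note D = Dirichlet_kernel_proportion[OF x(1) x' n_def q(2)]
    have q2: "q \<ge> 2" using q(2) by simp
    define s where "s = sin (pi * n q / q)"
    define \<sigma> where "\<sigma> = sin (pi / q)"
    have \<sigma>: "\<sigma> > 0"
      using sin_pi_div_pos[OF q2] by (simp add: \<sigma>_def)
    have "x / pi * real q \<le> 1 / 2 * real q"
      using x by (intro mult_right_mono) (auto simp: field_simps)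
    moreover have "real (n q) \<le> x / pi * real q"
      unfolding n_def using x by (intro of_nat_floor) simp
    ultimately have "2 * real (n q) \<le> q"
      by linarith
    then have n2: "2 * n q \<le> q"
      by (simp flip: of_nat_mult add: of_nat_le_iff)
    show "{0..<int (n q)} \<subseteq> {0..<int q}" "{0..<int (n q)} \<noteq> {}"
      using D by auto
    have r0: "r q \<ge> 0"
      using \<sigma> by (simp add: r_def)
    have "r q * (\<Sum>k\<in>{0..<int q}. cmod (idem q {0..<int (n q)} k) ^ 4) \<le> r q * (q * ((2 * real (n q) ^ 3 + n q) / 3))"
      by (intro mult_left_mono Dirichlet_kernel_fourth_power_le D n2 r0)
    also have "\<dots> = 2 * (s / \<sigma>) ^ 4"
    proof -
      define N where "N = 2 * real (n q) ^ 3 + n q"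
      have N0: "N > 0" using D by (simp add: N_def add_nonneg_pos)
      have "2 * (n q / q) ^ 3 + (n q / q) * (1 / q)\<^sup>2 = N / q ^ 3"
        using q2 by (simp add: N_def field_simps power2_eq_square power3_eq_cube)
      then have "r q = 2 * s ^ 4 * 3 / ((q * \<sigma>) ^ 4 * (N / q ^ 3))"
        by (simp add: r_def s_def \<sigma>_def)
      then show ?thesis
        using q2 \<sigma> N0 unfolding N_def[symmetric]
        by (simp add: power_mult_distrib power_divide eval_nat_numeral)
    qed
    also have "\<dots> = 2 * cmod (idem q {0..<int (n q)} 1) ^ 4"
      unfolding D(3) s_def \<sigma>_def by simp
    finally show "r q * (\<Sum>k\<in>{0..<int q}. cmod (idem q {0..<int (n q)} k) powr 4)
        \<le> 2 * cmod (idem q {0..<int (n q)} 1) powr 4"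
      by simp
  qed (use q in auto)
qed

text \<open>
  The lower bound is maximal where \<open>4 x = 3 tan x\<close>, near \<open>0.845\<close>, with the value \<open>0.49538\<dots>\<close>.
\<close>

theorem gamma_sharp_4: "ereal 0.495 < gamma_sharp 4" "gamma_sharp 4 \<le> ereal (1 / 2)"
proof -
  have "sin 0.85 \<ge> (0.75128 :: real)"
    using sin_Taylor_bound[of "0.85"] unfolding abs_le_iff by (simp add: power_divide)
  then have "(0.75128 :: real) ^ 4 \<le> sin 0.85 ^ 4"
    by (rule power_mono) simp
  moreover have "0.4951 * (pi * 0.85 ^ 3) \<le> 0.4951 * (31415927 / 10000000 * 0.85 ^ 3)"
    using pi_bounds by (intro mult_left_mono mult_right_mono) auto
  moreover have "0.4951 * (31415927 / 10000000 * 0.85 ^ 3) \<le> 3 * (0.75128 :: real) ^ 4"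
    by (simp add: power_divide)
  ultimately have "0.4951 * (pi * 0.85 ^ 3) \<le> 3 * sin 0.85 ^ 4"
    by argo
  moreover have "0 < pi * 0.85 ^ 3"
    by simp
  ultimately have "0.4951 \<le> 3 * sin 0.85 ^ 4 / (pi * 0.85 ^ 3)"
    by (simp only: pos_le_divide_eq)
  then have "ereal 0.495 < ereal (3 * sin 0.85 ^ 4 / (pi * 0.85 ^ 3))"
    by simp
  also have "\<dots> \<le> gamma_sharp 4"
    using pi_bounds by (intro gamma_sharp_4_ge) auto
  finally show "ereal 0.495 < gamma_sharp 4" .
qed (rule gamma_sharp_4_le)

section \<open>Rounding weights to idempotents\<close>

text \<open>
  The only term of the order \<open>|z|^3\<close> is linear in \<open>a\<close>, so that its sign can be controlled by choosing the
  sign of \<open>a\<close>; terms of lower order are bounded crudely.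
\<close>

lemma fourth_power_step:
  fixes z u :: complex and a :: real
  assumes "cmod u = 1" "\<bar>a\<bar> \<le> 1"
  shows "cmod (z + a * u) ^ 4 \<le> cmod z ^ 4 + a * (4 * Re (z * cnj u) * (cmod z)\<^sup>2) + 8 * (cmod z)\<^sup>2 + 3"
proof -
  define N where "N = (cmod z)\<^sup>2"
  define R where "R = Re (z * cnj u)"
  have N0: "N \<ge> 0" by (simp add: N_def)
  have "\<bar>R\<bar> \<le> cmod (z * cnj u)"
    unfolding R_def by (rule abs_Re_le_cmod)
  then have "R\<^sup>2 \<le> (cmod z)\<^sup>2"
    using assms(1) by (simp add: norm_mult power2_le_iff_abs_le)
  then have R: "R\<^sup>2 \<le> N"
    by (simp add: N_def)
  have a: "a\<^sup>2 \<le> 1"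
    using assms(2) by (simp add: abs_square_le_1)
  have "(cmod (z + a * u))\<^sup>2 = N + 2 * a * R + a\<^sup>2"
  proof -
    have "(Re u)\<^sup>2 + (Im u)\<^sup>2 = 1"
      using assms(1) by (simp add: cmod_def)
    then have "a\<^sup>2 * (Re u)\<^sup>2 + a\<^sup>2 * (Im u)\<^sup>2 = a\<^sup>2"
      by (metis distrib_left mult.right_neutral)
    then show ?thesis
      unfolding N_def R_def cmod_power2 by (simp add: power2_eq_square algebra_simps)
  qed
  moreover have "cmod (z + a * u) ^ 4 = ((cmod (z + a * u))\<^sup>2)\<^sup>2"
    by simp
  ultimately have "cmod (z + a * u) ^ 4 = (N + 2 * a * R + a\<^sup>2)\<^sup>2"
    by (simp only:)
  also have "\<dots> = N\<^sup>2 + a * (4 * R * N) + a\<^sup>2 * (4 * R\<^sup>2 + 2 * N + a * (4 * R) + a\<^sup>2)"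
    by (simp add: power2_eq_square algebra_simps)
  finally have expand: "cmod (z + a * u) ^ 4
      = N\<^sup>2 + a * (4 * R * N) + a\<^sup>2 * (4 * R\<^sup>2 + 2 * N + a * (4 * R) + a\<^sup>2)" .
  define E where "E = a\<^sup>2 * (4 * R\<^sup>2 + 2 * N + a * (4 * R) + a\<^sup>2)"
  have "a * (4 * R) \<le> 2 * a\<^sup>2 + 2 * R\<^sup>2"
    using zero_le_power2[of "a - R"] by (simp add: power2_diff)
  then have "a\<^sup>2 * (4 * R\<^sup>2 + 2 * N + a * (4 * R) + a\<^sup>2) \<le> a\<^sup>2 * (8 * N + 3)"
    using R a by (intro mult_left_mono) auto
  also have "\<dots> \<le> 1 * (8 * N + 3)"
    using a N0 by (intro mult_right_mono) auto
  finally have "E \<le> 8 * N + 3"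
    by (simp add: E_def)
  then have "cmod (z + a * u) ^ 4 \<le> N\<^sup>2 + a * (4 * R * N) + 8 * N + 3"
    unfolding expand E_def[symmetric] by linarith
  moreover have "cmod z ^ 4 = N\<^sup>2"
    by (simp add: N_def)
  ultimately show ?thesis
    by (simp only: N_def R_def)
qed

lemma rounding_error_energy:
  assumes "q > 0" and w: "\<And>h. 0 \<le> w h \<and> w h \<le> (1::real)" and "H \<subseteq> {0..<int n}" "n \<le> q"
  shows "(\<Sum>k\<in>{0..<int q}. (cmod (idem q H k - (\<Sum>h\<in>{0..<int n}. of_real (w h) * zq_char q h k)))\<^sup>2) \<le> real q * n"
proof -
  define c where "c h = complex_of_real (of_bool (h \<in> H) - w h)" for h :: int
  have "idem q H k = (\<Sum>h\<in>{0..<int n}. complex_of_real (of_bool (h \<in> H)) * zq_char q h k)" for k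
  proof -
    have "(\<Sum>h\<in>{0..<int n}. complex_of_real (of_bool (h \<in> H)) * zq_char q h k) = (\<Sum>h\<in>{0..<int n}. if h \<in> H then zq_char q h k else 0)"
      by (intro sum.cong) auto
    also have "\<dots> = (\<Sum>h\<in>{0..<int n} \<inter> H. zq_char q h k)"
      by (simp add: sum.inter_restrict)
    also have "{0..<int n} \<inter> H = H"
      using assms(3) by auto
    finally show ?thesis
      by (simp add: idem_def)
  qed
  then have "idem q H k - (\<Sum>h\<in>{0..<int n}. of_real (w h) * zq_char q h k) = (\<Sum>h\<in>{0..<int n}. c h * zq_char q h k)" for k
    by (simp only: c_def of_real_diff sum_subtractf left_diff_distrib)
  then have "(\<Sum>k\<in>{0..<int q}. (cmod (idem q H k - (\<Sum>h\<in>{0..<int n}. of_real (w h) * zq_char q h k)))\<^sup>2)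
      = q * (\<Sum>h\<in>{0..<int n}. (cmod (c h))\<^sup>2)"
    using Parseval_window[OF assms(1), of "{0..<int n}" 0 c] assms(4) by simp
  also have "(\<Sum>h\<in>{0..<int n}. (cmod (c h))\<^sup>2) \<le> (\<Sum>h\<in>{0..<int n}. 1)"
  proof (intro sum_mono)
    fix h
    have "\<bar>of_bool (h \<in> H) - w h\<bar> \<le> 1"
      using w[of h] by auto
    then show "(cmod (c h))\<^sup>2 \<le> 1"
      unfolding c_def norm_of_real by (simp add: abs_square_le_1)
  qed
  finally show ?thesis
    by (simp add: mult_left_mono)
qed

text \<open>
  The decision whether to include \<open>n\<close> changes the error at frequency \<open>k\<close> by \<open>a u k\<close>, where \<open>a\<close> is \<open>1 - w n\<close>
  or \<open>- w n\<close>. These have opposite signs, so one of them makes the term linear in \<open>a\<close>, summed over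
  all \<open>k\<close>, nonpositive. What remains is controlled by the second moment, which Parseval bounds for every
  choice.
\<close>

lemma greedy_rounding:
  assumes q: "q > 0" and w: "\<And>h. 0 \<le> w h \<and> w h \<le> (1::real)" and "n \<le> q"
  shows "\<exists>H\<subseteq>{0..<int n}. (\<Sum>k\<in>{0..<int q}. cmod (idem q H k - (\<Sum>h\<in>{0..<int n}. of_real (w h) * zq_char q h k)) ^ 4) \<le> 11 * real q ^ 2 * n"
  using assms(3)
proof (induction n)
  case 0
  show ?case by (auto simp: idem_def)
next
  case (Suc n)
  then obtain H where H: "H \<subseteq> {0..<int n}"
    and IH: "(\<Sum>k\<in>{0..<int q}. cmod (idem q H k - (\<Sum>h\<in>{0..<int n}. of_real (w h) * zq_char q h k)) ^ 4) \<le> 11 * real q ^ 2 * n"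
    by auto
  define z where "z k = idem q H k - (\<Sum>h\<in>{0..<int n}. of_real (w h) * zq_char q h k)" for k
  define u where "u k = zq_char q (int n) k" for k
  define B where "B = (\<Sum>k\<in>{0..<int q}. 4 * Re (z k * cnj (u k)) * (cmod (z k))\<^sup>2)"
  \<comment> \<open>the choice that gives \<open>a B\<close> the sign \<open>\<le> 0\<close>\<close>
  define a where "a = (if B \<le> 0 then 1 - w (int n) else - w (int n))"
  define H' where "H' = (if B \<le> 0 then insert (int n) H else H)"
  have split: "{0..<int (Suc n)} = insert (int n) {0..<int n}"
    by auto
  have finH: "finite H" "int n \<notin> H"
    using H finite_subset[OF H] by auto
  have z': "idem q H' k - (\<Sum>h\<in>{0..<int (Suc n)}. of_real (w h) * zq_char q h k) = z k + a * u k" for k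
    unfolding split using finH by (auto simp: H'_def a_def z_def u_def idem_def algebra_simps)
  have aB: "a * B \<le> 0"
    using w[of "int n"] by (auto simp: a_def mult_nonneg_nonpos mult_nonpos_nonneg)
  have a1: "\<bar>a\<bar> \<le> 1"
    using w[of "int n"] by (auto simp: a_def)
  have energy: "(\<Sum>k\<in>{0..<int q}. (cmod (z k))\<^sup>2) \<le> real q * n"
    unfolding z_def using Suc.prems by (intro rounding_error_energy[where w = w, OF q w H]) simp
  have "real q * n \<le> real q * q" "real q * 1 \<le> real q * q"
    using q Suc.prems by (intro mult_left_mono; simp)+
  then have n_le: "8 * (real q * n) + 3 * q \<le> 11 * real q ^ 2"
    by (simp add: power2_eq_square)
  have "(\<Sum>k\<in>{0..<int q}. cmod (z k + a * u k) ^ 4)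
      \<le> (\<Sum>k\<in>{0..<int q}. cmod (z k) ^ 4 + a * (4 * Re (z k * cnj (u k)) * (cmod (z k))\<^sup>2) + 8 * (cmod (z k))\<^sup>2 + 3)"
    by (intro sum_mono fourth_power_step a1) (simp add: u_def)
  also have "\<dots> = (\<Sum>k\<in>{0..<int q}. cmod (z k) ^ 4) + a * B + 8 * (\<Sum>k\<in>{0..<int q}. (cmod (z k))\<^sup>2) + 3 * q"
    by (simp add: sum.distrib B_def sum_distrib_left)
  also have "\<dots> \<le> 11 * real q ^ 2 * n + 0 + 8 * (real q * n) + 3 * q"
    using IH aB energy unfolding z_def[symmetric] by (intro add_mono) auto
  also have "\<dots> \<le> 11 * real q ^ 2 * Suc n"
    using n_le by (simp add: distrib_left)
  finally show ?case
    unfolding z'[symmetric] using H by (intro exI[of _ H']) (auto simp: H'_def)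
qed

text \<open>
  The fourth moment is at most \<open>11 q\<^sup>3\<close>, and \<open>11 \<le> 2^4\<close>. What matters is that the exponent \<open>3 / 4\<close> is below
  \<open>1\<close>, the order of \<open>|f 1|\<close>.
\<close>

lemma exists_rounding:
  assumes q: "q > 0" and w: "\<And>h. 0 \<le> w h \<and> w h \<le> (1::real)"
  shows "\<exists>H\<subseteq>{0..<int q}.
    (\<forall>k\<in>{0..<int q}. cmod (idem q H k - (\<Sum>h\<in>{0..<int q}. of_real (w h) * zq_char q h k)) \<le> 2 * real q powr (3 / 4)) \<and>
    (\<Sum>k\<in>{0..<int q}. (cmod (idem q H k - (\<Sum>h\<in>{0..<int q}. of_real (w h) * zq_char q h k)))\<^sup>2) \<le> real q * q"
proof -
  obtain H where H: "H \<subseteq> {0..<int q}"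
    and le: "(\<Sum>k\<in>{0..<int q}. cmod (idem q H k - (\<Sum>h\<in>{0..<int q}. of_real (w h) * zq_char q h k)) ^ 4) \<le> 11 * real q ^ 2 * q"
    using greedy_rounding[where w = w, OF q w, of q] by auto
  have "cmod (idem q H k - (\<Sum>h\<in>{0..<int q}. of_real (w h) * zq_char q h k)) \<le> 2 * real q powr (3 / 4)"
    if k: "k \<in> {0..<int q}" for k
  proof (rule power_le_imp_le_base)
    have "cmod (idem q H k - (\<Sum>h\<in>{0..<int q}. of_real (w h) * zq_char q h k)) ^ 4
        \<le> (\<Sum>k\<in>{0..<int q}. cmod (idem q H k - (\<Sum>h\<in>{0..<int q}. of_real (w h) * zq_char q h k)) ^ 4)"
      by (rule member_le_sum[OF k]) auto
    also have "\<dots> \<le> 16 * real q ^ 3"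
    proof -
      have "11 * real q ^ 2 * q = 11 * real q ^ 3"
        by (simp add: power2_eq_square power3_eq_cube)
      moreover have "0 \<le> real q ^ 3"
        by simp
      ultimately show ?thesis
        using le by linarith
    qed
    also have "\<dots> = (2 * real q powr (3 / 4)) ^ Suc 3"
    proof -
      have "(real q powr (3 / 4)) ^ 4 = real q powr 3"
        using q by (simp add: powr_power)
      then show ?thesis
        by (simp add: power_mult_distrib)
    qed
    finally show "cmod (idem q H k - (\<Sum>h\<in>{0..<int q}. of_real (w h) * zq_char q h k)) ^ Suc 3 \<le> (2 * real q powr (3 / 4)) ^ Suc 3"
      by simp
  qed simp
  then show ?thesis
    using H rounding_error_energy[where w = w, OF q w H] by blast
qed

section \<open>Gaussian weights from a lazy random walk\<close>

text \<open>
  The distribution modulo \<open>q\<close>, after \<open>M\<close> steps, of the random walk on the integers that stays with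
  probability \<open>1 / 2\<close> and moves by \<open>1\<close> or \<open>- 1\<close> with probability \<open>1 / 4\<close> each. It is defined by its Fourier
  transform \<open>cos\<^sup>2 (pi j / q)\<close> to the power \<open>M\<close>, which makes the transform and the uniform bound immediate;
  nonnegativity then comes from the recursion.
\<close>

definition walk :: "nat \<Rightarrow> nat \<Rightarrow> int \<Rightarrow> complex" where
  "walk q M h = (\<Sum>j\<in>{0..<int q}. of_real (cos (pi * of_int j / q) ^ (2 * M)) * zq_char q j (- h)) / of_nat q"

lemma walk_Suc: "walk q (Suc M) h = (2 * walk q M h + walk q M (h - 1) + walk q M (h + 1)) / 4"
proof -
  have "of_real (cos (pi * of_int j / q) ^ (2 * Suc M)) * zq_char q j (- h)
      = (of_real (cos (pi * of_int j / q) ^ (2 * M)) * (2 * zq_char q j (- h) + zq_char q j (- (h - 1)) + zq_char q j (- (h + 1)))) / 4"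
    for j :: int
  proof -
    have "zq_char q j 1 + zq_char q j (- 1) = of_real (2 * cos (2 * (pi * of_int j / q)))"
      by (simp add: zq_char_eq_cis complex_eq_iff mult_ac)
    also have "\<dots> = of_real (4 * (cos (pi * of_int j / q))\<^sup>2 - 2)"
      unfolding cos_double_cos by simp
    finally have "4 * of_real ((cos (pi * of_int j / q))\<^sup>2) = 2 + zq_char q j 1 + zq_char q j (- 1)"
      by (simp add: add.assoc)
    then have "4 * of_real ((cos (pi * of_int j / q))\<^sup>2) * zq_char q j (- h)
        = 2 * zq_char q j (- h) + zq_char q j (- (h - 1)) + zq_char q j (- (h + 1))"
      using zq_char_add_right[of q j "- h" 1] zq_char_add_right[of q j "- h" "- 1"]
      by (simp add: algebra_simps)
    then have "of_real ((cos (pi * of_int j / q))\<^sup>2) * zq_char q j (- h)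
        = (2 * zq_char q j (- h) + zq_char q j (- (h - 1)) + zq_char q j (- (h + 1))) / 4"
      by (simp only: eq_divide_eq mult_ac) simp
    moreover have "cos (pi * of_int j / q) ^ (2 * Suc M) = cos (pi * of_int j / q) ^ (2 * M) * (cos (pi * of_int j / q))\<^sup>2"
      by (simp add: power2_eq_square)
    ultimately show ?thesis
      by (simp only: of_real_mult mult.assoc times_divide_eq_right)
  qed
  then have "walk q (Suc M) h
      = (\<Sum>j\<in>{0..<int q}. of_real (cos (pi * of_int j / q) ^ (2 * M)) * (2 * zq_char q j (- h) + zq_char q j (- (h - 1)) + zq_char q j (- (h + 1)))) / 4 / of_nat q"
    by (simp only: walk_def sum_divide_distrib)
  also have "\<dots> = (2 * walk q M h + walk q M (h - 1) + walk q M (h + 1)) / 4"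
    unfolding walk_def by (simp add: distrib_left sum.distrib sum_distrib_left add_divide_distrib mult_ac)
  finally show ?thesis .
qed

lemma walk_nonneg:
  assumes "q > 0"
  shows "\<exists>r\<ge>0. walk q M h = of_real r"
proof (induction M arbitrary: h)
  case 0
  have "walk q 0 h = (\<Sum>j\<in>{0..<int q}. zq_char q (- h) j) / of_nat q"
    by (simp add: walk_def zq_char_commute[of q "- h"])
  also have "\<dots> = of_real (of_bool (int q dvd h))"
    using assms by (simp add: sum_zq_char)
  finally show ?case by (intro exI[of _ "of_bool (int q dvd h)"]) auto
next
  case (Suc M)
  obtain r1 r2 r3 where r: "r1 \<ge> 0" "walk q M h = of_real r1" "r2 \<ge> 0" "walk q M (h - 1) = of_real r2"
    "r3 \<ge> 0" "walk q M (h + 1) = of_real r3"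
    using Suc by metis
  then have "walk q (Suc M) h = of_real ((2 * r1 + r2 + r3) / 4)"
    by (simp add: walk_Suc)
  then show ?case
    using r by (intro exI[of _ "(2 * r1 + r2 + r3) / 4"]) simp
qed

lemma walk_transform:
  assumes q: "q > 0" and k: "k \<in> {0..<int q}"
  shows "(\<Sum>h\<in>{0..<int q}. walk q M h * zq_char q h k) = of_real (cos (pi * of_int k / q) ^ (2 * M))"
proof -
  define F where "F j = complex_of_real (cos (pi * of_int j / q) ^ (2 * M))" for j :: int
  have "(\<Sum>h\<in>{0..<int q}. walk q M h * zq_char q h k)
      = (\<Sum>h\<in>{0..<int q}. \<Sum>j\<in>{0..<int q}. F j * zq_char q (k - j) h) / of_nat q"
    unfolding walk_def sum_divide_distrib sum_distrib_right F_def
    by (intro sum.cong refl) (simp add: zq_char_diff_left zq_char_minus_right zq_char_commute[of q k] mult_ac)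
  also have "(\<Sum>h\<in>{0..<int q}. \<Sum>j\<in>{0..<int q}. F j * zq_char q (k - j) h)
      = (\<Sum>j\<in>{0..<int q}. F j * (\<Sum>h\<in>{0..<int q}. zq_char q (k - j) h))"
    by (subst sum.swap) (simp add: sum_distrib_left)
  also have "\<dots> = (\<Sum>j\<in>{0..<int q}. if j = k then F j * of_nat q else 0)"
  proof (intro sum.cong refl)
    fix j assume j: "j \<in> {0..<int q}"
    have "int q dvd k - j \<longleftrightarrow> j = k"
      using dvd_diff_window[of k 0 q j] j k by auto
    then show "F j * (\<Sum>h\<in>{0..<int q}. zq_char q (k - j) h) = (if j = k then F j * of_nat q else 0)"
      by (simp add: sum_zq_char[OF q])
  qed
  also have "\<dots> / of_nat q = F k"
    using q k by simp
  finally show ?thesis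
    by (simp add: F_def)
qed

lemma norm_walk_le: "cmod (walk q M h) \<le> (\<Sum>j\<in>{0..<int q}. cos (pi * of_int j / q) ^ (2 * M)) / q"
proof -
  have "cmod (of_real (cos (pi * of_int j / q) ^ (2 * M)) * zq_char q j (- h)) = cos (pi * of_int j / q) ^ (2 * M)"
    for j :: int
  proof -
    have "0 \<le> cos (pi * of_int j / q) ^ (2 * M)"
      by (simp add: power_mult)
    then show ?thesis
      by (simp only: norm_mult norm_of_real norm_zq_char abs_of_nonneg mult.right_neutral)
  qed
  then have "cmod (\<Sum>j\<in>{0..<int q}. of_real (cos (pi * of_int j / q) ^ (2 * M)) * zq_char q j (- h))
      \<le> (\<Sum>j\<in>{0..<int q}. cos (pi * of_int j / q) ^ (2 * M))"
    by (intro sum_norm_le) simp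
  then show ?thesis
    unfolding walk_def by (simp add: norm_divide divide_right_mono)
qed

text \<open>
  The function \<open>cos y exp (y\<^sup>2 / 2)\<close> decreases, since its derivative has the sign of \<open>y cos y - sin y\<close>. The
  constant \<open>1 / 2\<close> in the exponent agrees with the expansion at \<open>0\<close>, so that for large \<open>q\<close> nothing is lost at
  the low frequencies.
\<close>

lemma cos_le_exp:
  fixes x :: real
  assumes "0 \<le> x" "x \<le> pi / 2"
  shows "cos x \<le> exp (- x\<^sup>2 / 2)"
proof -
  have sin_ge: "y * cos y \<le> sin y" if "0 \<le> y" "y \<le> pi / 2" for y :: real
  proof -
    have "(\<lambda>y. sin y - y * cos y) 0 \<le> (\<lambda>y. sin y - y * cos y) y"
    proof (rule DERIV_nonneg_imp_nondecreasing[OF that(1)])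
      fix t assume t: "0 \<le> t" "t \<le> y"
      have "((\<lambda>y. sin y - y * cos y) has_real_derivative t * sin t) (at t)"
        by (auto intro!: derivative_eq_intros)
      moreover have "t * sin t \<ge> 0"
        using t that by (intro mult_nonneg_nonneg sin_ge_zero) auto
      ultimately show "\<exists>d. ((\<lambda>y. sin y - y * cos y) has_real_derivative d) (at t) \<and> 0 \<le> d"
        by blast
    qed
    then show ?thesis by simp
  qed
  have "(\<lambda>y. cos y * exp (y\<^sup>2 / 2)) x \<le> (\<lambda>y. cos y * exp (y\<^sup>2 / 2)) 0"
  proof (rule DERIV_nonpos_imp_nonincreasing[OF assms(1)])
    fix t assume t: "0 \<le> t" "t \<le> x"
    have "((\<lambda>y. cos y * exp (y\<^sup>2 / 2)) has_real_derivative (t * cos t - sin t) * exp (t\<^sup>2 / 2)) (at t)"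
      by (auto intro!: derivative_eq_intros simp: algebra_simps)
    moreover have "(t * cos t - sin t) * exp (t\<^sup>2 / 2) \<le> 0"
      using sin_ge[of t] t assms by (intro mult_nonpos_nonneg) auto
    ultimately show "\<exists>d. ((\<lambda>y. cos y * exp (y\<^sup>2 / 2)) has_real_derivative d) (at t) \<and> d \<le> 0"
      by blast
  qed
  then have "cos x * exp (x\<^sup>2 / 2) \<le> 1"
    by simp
  then show ?thesis
    by (simp add: exp_minus field_simps)
qed

lemma cos_power_le:
  assumes q: "q = 2 * m + 1" and k: "k \<le> m" and \<rho>: "exp (- (real M * pi\<^sup>2 / (real q)\<^sup>2)) \<le> \<rho>"
  shows "cos (pi * real k / q) ^ (2 * M) \<le> \<rho> ^ k\<^sup>2"
proof -
  have "pi * (2 * k) \<le> pi * q"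
    using q k by (intro mult_left_mono) auto
  then have x: "0 \<le> pi * real k / q" "pi * real k / q \<le> pi / 2"
    using q by (auto simp: field_simps)
  have x': "- (pi / 2) \<le> pi * real k / q"
    using x(1) pi_gt_zero by linarith
  have "cos (pi * real k / q) ^ (2 * M) \<le> exp (- (pi * real k / q)\<^sup>2 / 2) ^ (2 * M)"
    using x x' by (intro power_mono cos_le_exp cos_ge_zero) auto
  also have "\<dots> = exp (- (real M * pi\<^sup>2 / (real q)\<^sup>2)) ^ k\<^sup>2"
    by (simp flip: exp_of_nat_mult add: power_divide power_mult_distrib mult_ac)
  also have "\<dots> \<le> \<rho> ^ k\<^sup>2"
    using \<rho> by (intro power_mono) auto
  finally show ?thesis .
qed

lemma sum_cos_power:
  assumes q: "q = 2 * m + 1"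
  shows "(\<Sum>j\<in>{0..<int q}. (cos (pi * of_int j / q) ^ (2 * M)) powr p)
    = 1 + 2 * (\<Sum>k=1..m. (cos (pi * real k / q) ^ (2 * M)) powr p)"
proof -
  define g where "g j = (cos (pi * of_int j / q) ^ (2 * M)) powr p" for j :: int
  have "sum g {0..<int q} = g 0 + 2 * (\<Sum>k=1..m. g (int k))"
  proof (rule sum_periodic_even[OF _ _ q])
    fix x
    have "pi * of_int (x + int q) / q = pi * of_int x / q + pi"
      using q by (simp add: field_simps)
    then show "g (x + int q) = g x"
      by (simp add: g_def power_mult)
  qed (simp add: g_def)
  then show ?thesis
    by (simp add: g_def)
qed

text \<open>
  Adding \<open>0.03\<close> times the last term gives a quantity that decreases from \<open>m = 3\<close> on, because
  \<open>1.03 (3 / 5)^7 \<le> 0.03\<close>.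
\<close>

lemma sum_theta_le:
  assumes "m \<ge> 3"
  shows "(\<Sum>k=1..m. (3 / 5 :: real) ^ k\<^sup>2) \<le> 37 / 50"
proof -
  have "(\<Sum>k=1..m. (3 / 5 :: real) ^ k\<^sup>2) + 3 / 100 * (3 / 5) ^ m\<^sup>2 \<le> 37 / 50"
    using assms
  proof (induction m rule: dec_induct)
    case base
    have "{1..3::nat} = {1, 2, 3}" by auto
    then show ?case by (simp add: power_divide)
  next
    case (step m)
    have "(3 / 5 :: real) ^ (2 * m + 1) \<le> (3 / 5) ^ 7"
      using step by (intro power_decreasing) auto
    then have "(3 / 5 :: real) ^ (2 * m + 1) \<le> 3 / 103"
      by (simp add: power_divide)
    then have "(3 / 5 :: real) ^ m\<^sup>2 * (3 / 5) ^ (2 * m + 1) \<le> (3 / 5) ^ m\<^sup>2 * (3 / 103)"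
      by (intro mult_left_mono) auto
    moreover have "(3 / 5 :: real) ^ (Suc m)\<^sup>2 = (3 / 5) ^ m\<^sup>2 * (3 / 5) ^ (2 * m + 1)"
      by (simp flip: power_add add: power2_eq_square mult_2 add_ac)
    ultimately have "103 / 100 * (3 / 5 :: real) ^ (Suc m)\<^sup>2 \<le> 3 / 100 * (3 / 5) ^ m\<^sup>2"
      by linarith
    moreover have "(\<Sum>k=1..Suc m. (3 / 5 :: real) ^ k\<^sup>2) = (\<Sum>k=1..m. (3 / 5) ^ k\<^sup>2) + (3 / 5) ^ (Suc m)\<^sup>2"
      by simp
    ultimately show ?case
      using step.IH by linarith
  qed
  moreover have "0 \<le> 3 / 100 * (3 / 5 :: real) ^ m\<^sup>2"
    by simp
  ultimately show ?thesis by linarith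
qed

section \<open>Exponents above two\<close>

text \<open>
  The factor of \<open>a powr p\<close> can be brought as close to \<open>1\<close> as desired, at the expense of the error term \<open>b\<close>.
\<close>

lemma powr_add_le:
  fixes a b \<epsilon> p :: real
  assumes "0 \<le> a" "0 \<le> b" "0 < \<epsilon>" "0 \<le> p"
  shows "(a + b) powr p \<le> (1 + \<epsilon>) powr p * a powr p + (1 + 1 / \<epsilon>) powr p * b powr p"
proof (cases "b \<le> \<epsilon> * a")
  case True
  then have "(a + b) powr p \<le> ((1 + \<epsilon>) * a) powr p"
    using assms by (intro powr_mono2) (auto simp: algebra_simps)
  also have "\<dots> = (1 + \<epsilon>) powr p * a powr p"
    using assms by (simp add: powr_mult)
  finally show ?thesis
    by (simp add: add_increasing2)
next
  case False
  then have "a \<le> b / \<epsilon>"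
    using assms by (simp add: field_simps)
  then have "(a + b) powr p \<le> ((1 + 1 / \<epsilon>) * b) powr p"
    using assms by (intro powr_mono2) (auto simp: algebra_simps)
  also have "\<dots> = (1 + 1 / \<epsilon>) powr p * b powr p"
    using assms by (simp add: powr_mult)
  finally show ?thesis
    by (simp add: add_increasing)
qed

text \<open>
  The walk has values of order \<open>1 / q\<close> once the number of steps is of order \<open>q\<^sup>2\<close>. Scaled by \<open>q / D\<close> it is a
  system of weights in \<open>[0, 1]\<close>, to be rounded.
\<close>

lemma exists_near_Gaussian_idempotent:
  assumes q: "q = 2 * m + 1" and M: "exp (- (real M * pi\<^sup>2 / (real q)\<^sup>2)) \<le> \<rho>" "\<rho> < 1"
    and D: "D = (1 + \<rho>) / (1 - \<rho>)"
  shows "\<exists>H z. H \<subseteq> {0..<int q} \<and>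
    (\<forall>k\<in>{0..<int q}. idem q H k = of_real (q / D * cos (pi * of_int k / q) ^ (2 * M)) + z k) \<and>
    (\<forall>k\<in>{0..<int q}. cmod (z k) \<le> 2 * real q powr (3 / 4)) \<and>
    (\<Sum>k\<in>{0..<int q}. (cmod (z k))\<^sup>2) \<le> real q * q"
proof -
  have q0: "q > 0" using q by simp
  have "0 < exp (- (real M * pi\<^sup>2 / (real q)\<^sup>2))" by simp
  then have \<rho>: "0 < \<rho>" using M by linarith
  have D0: "D > 0" using \<rho> M by (simp add: D)
  have walk_le: "cmod (walk q M h) \<le> D / q" for h
  proof -
    have "(\<Sum>j\<in>{0..<int q}. cos (pi * of_int j / q) ^ (2 * M)) = 1 + 2 * (\<Sum>k=1..m. cos (pi * real k / q) ^ (2 * M))"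
      using sum_cos_power[OF q, of M 1] by (simp add: power_mult)
    also have "(\<Sum>k=1..m. cos (pi * real k / q) ^ (2 * M)) \<le> (\<Sum>k=1..m. \<rho> ^ k)"
    proof (intro sum_mono)
      fix k assume k: "k \<in> {1..m}"
      have "cos (pi * real k / q) ^ (2 * M) \<le> \<rho> ^ k\<^sup>2"
        using k by (intro cos_power_le[OF q _ M(1)]) auto
      also have "\<dots> \<le> \<rho> ^ k"
        using \<rho> M by (intro power_decreasing) (auto simp: power2_eq_square)
      finally show "cos (pi * real k / q) ^ (2 * M) \<le> \<rho> ^ k" .
    qed
    also have "(\<Sum>k=1..m. \<rho> ^ k) \<le> \<rho> / (1 - \<rho>)"
    proof -
      have "(\<Sum>k=1..m. \<rho> ^ k) = (\<rho> - \<rho> ^ Suc m) / (1 - \<rho>)"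
        using M by (cases "m = 0") (auto simp: sum_gp)
      also have "\<dots> \<le> \<rho> / (1 - \<rho>)"
        using \<rho> M by (intro divide_right_mono) auto
      finally show ?thesis .
    qed
    also have "1 + 2 * (\<rho> / (1 - \<rho>)) = D"
      using M by (simp add: D field_simps)
    finally have "(\<Sum>j\<in>{0..<int q}. cos (pi * of_int j / q) ^ (2 * M)) / q \<le> D / q"
      using q0 by (intro divide_right_mono) auto
    then show ?thesis
      using norm_walk_le[of q M h] by linarith
  qed
  define w where "w h = q / D * Re (walk q M h)" for h
  have w_eq: "complex_of_real (w h) = of_real (q / D) * walk q M h" for h
    using walk_nonneg[OF q0, of M h] by (auto simp: w_def)
  have w: "0 \<le> w h \<and> w h \<le> 1" for h
  proof -
    have "Re (walk q M h) \<ge> 0"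
      using walk_nonneg[OF q0, of M h] by auto
    then have "w h \<ge> 0"
      using D0 by (simp add: w_def)
    moreover have "w h \<le> q / D * (D / q)"
      unfolding w_def using walk_le[of h] complex_Re_le_cmod[of "walk q M h"] D0
      by (intro mult_left_mono) auto
    ultimately show ?thesis
      using q0 D0 by simp
  qed
  obtain H where H: "H \<subseteq> {0..<int q}"
    "\<forall>k\<in>{0..<int q}. cmod (idem q H k - (\<Sum>h\<in>{0..<int q}. of_real (w h) * zq_char q h k)) \<le> 2 * real q powr (3 / 4)"
    "(\<Sum>k\<in>{0..<int q}. (cmod (idem q H k - (\<Sum>h\<in>{0..<int q}. of_real (w h) * zq_char q h k)))\<^sup>2) \<le> real q * q"
    using exists_rounding[where w = w, OF q0 w] by blast
  define z where "z k = idem q H k - (\<Sum>h\<in>{0..<int q}. of_real (w h) * zq_char q h k)" for k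
  show ?thesis
  proof (intro exI[of _ H] exI[of _ z] conjI ballI H(1))
    fix k assume k: "k \<in> {0..<int q}"
    have "(\<Sum>h\<in>{0..<int q}. of_real (w h) * zq_char q h k) = of_real (q / D) * (\<Sum>h\<in>{0..<int q}. walk q M h * zq_char q h k)"
      by (simp only: w_eq mult.assoc sum_distrib_left)
    also have "\<dots> = of_real (q / D * cos (pi * of_int k / q) ^ (2 * M))"
      by (simp only: walk_transform[OF q0 k] of_real_mult)
    finally have eq: "(\<Sum>h\<in>{0..<int q}. of_real (w h) * zq_char q h k)
        = of_real (q / D * cos (pi * of_int k / q) ^ (2 * M))" .
    show "idem q H k = of_real (q / D * cos (pi * of_int k / q) ^ (2 * M)) + z k"
      unfolding z_def eq by (subst add.commute) (simp only: diff_add_cancel)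
  next
    show "cmod (z k) \<le> 2 * real q powr (3 / 4)" if "k \<in> {0..<int q}" for k
      using H(2) that unfolding z_def by blast
    show "(\<Sum>k\<in>{0..<int q}. (cmod (z k))\<^sup>2) \<le> real q * q"
      unfolding z_def by (rule H(3))
  qed
qed

text \<open>
  The number \<open>2.48 = 1 + 2 \<cdot> 0.74\<close> bounds the theta series at \<open>3 / 5\<close>. The two powers of \<open>q\<close> with negative
  exponents come from the rounding error, at frequency \<open>1\<close> and in the sum of \<open>p\<close>-th powers respectively;
  the latter is \<open>- (p - 2) / 4\<close> and therefore harmless exactly for \<open>p > 2\<close>.
\<close>

lemma gamma_sharp_q_ge_Gaussian:
  assumes p: "p > 2" and q: "q = 2 * m + 1" "m \<ge> 3" and M: "exp (- (real M * pi\<^sup>2 / (real q)\<^sup>2)) \<le> (3 / 5) powr (1 / p)"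
    and D: "D = (1 + (3 / 5) powr (1 / p)) / (1 - (3 / 5) powr (1 / p))" and \<epsilon>: "\<epsilon> > 0"
  shows "2 * max 0 (cos (pi / q) ^ (2 * M) - 2 * D * real q powr (- 1 / 4)) powr p /
     ((1 + \<epsilon>) powr p * 2.48 + (1 + 1 / \<epsilon>) powr p * (2 powr (p - 2) * D powr p * real q powr (- (p - 2) / 4)))
    \<le> gamma_sharp_q p q"
proof -
  define \<rho> where "\<rho> = (3 / 5 :: real) powr (1 / p)"
  have \<rho>: "0 < \<rho>" "\<rho> < 1"
    using p powr_less_mono2[of "1 / p" "3 / 5" 1] by (auto simp: \<rho>_def)
  have \<rho>_p: "\<rho> powr p = 3 / 5"
    using p by (simp add: \<rho>_def powr_powr)
  have D0: "D > 0" using \<rho> by (simp add: D flip: \<rho>_def)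
  have q0: "q > 0" using q by simp
  obtain H z where H: "H \<subseteq> {0..<int q}"
    and f': "\<forall>k\<in>{0..<int q}. idem q H k = of_real (q / D * cos (pi * of_int k / q) ^ (2 * M)) + z k"
    and z': "\<forall>k\<in>{0..<int q}. cmod (z k) \<le> 2 * real q powr (3 / 4)"
    and z_sum: "(\<Sum>k\<in>{0..<int q}. (cmod (z k))\<^sup>2) \<le> real q * q"
    using exists_near_Gaussian_idempotent[OF q(1) M[folded \<rho>_def] \<rho>(2) D[folded \<rho>_def]] by blast
  note f = bspec[OF f'] and z_le = bspec[OF z']
  define F where "F k = cos (pi * of_int k / q) ^ (2 * M)" for k :: int
  have F0: "F k \<ge> 0" for k
    by (simp add: F_def power_mult)
  define E where "E = 2 powr (p - 2) * D powr p * real q powr (- (p - 2) / 4)"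
  define X where "X = (1 + \<epsilon>) powr p * 2.48 + (1 + 1 / \<epsilon>) powr p * E"
  have X0: "X > 0"
    using \<epsilon> unfolding X_def E_def by (intro add_pos_nonneg) auto
  have sum_F: "(\<Sum>k\<in>{0..<int q}. F k powr p) \<le> 2.48"
  proof -
    have "(\<Sum>k=1..m. (cos (pi * real k / q) ^ (2 * M)) powr p) \<le> (\<Sum>k=1..m. (3 / 5) ^ k\<^sup>2)"
    proof (intro sum_mono)
      fix k assume k: "k \<in> {1..m}"
      have "(cos (pi * real k / q) ^ (2 * M)) powr p \<le> (\<rho> ^ k\<^sup>2) powr p"
        using k p M by (intro powr_mono2 cos_power_le[OF q(1)]) (auto simp: power_mult \<rho>_def)
      also have "\<dots> = (3 / 5) ^ k\<^sup>2"
      proof -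
        have "(\<rho> ^ k\<^sup>2) powr p = (\<rho> powr real (k\<^sup>2)) powr p"
          by (simp only: powr_realpow[OF \<rho>(1)])
        also have "\<dots> = (\<rho> powr p) powr real (k\<^sup>2)"
          by (simp only: powr_powr mult.commute)
        also have "\<dots> = (\<rho> powr p) ^ k\<^sup>2"
          using \<rho> by (intro powr_realpow) simp
        finally have "(\<rho> ^ k\<^sup>2) powr p = (\<rho> powr p) ^ k\<^sup>2" .
        then show ?thesis
          by (simp only: \<rho>_p)
      qed
      finally show "(cos (pi * real k / q) ^ (2 * M)) powr p \<le> (3 / 5) ^ k\<^sup>2" .
    qed
    also have "\<dots> \<le> 37 / 50"
      by (rule sum_theta_le[OF q(2)])
    finally show ?thesis
      unfolding F_def sum_cos_power[OF q(1)] by simp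
  qed
  have sum_z: "(\<Sum>k\<in>{0..<int q}. cmod (z k) powr p) \<le> (q / D) powr p * E"
  proof -
    have "(\<Sum>k\<in>{0..<int q}. cmod (z k) powr p) \<le> (\<Sum>k\<in>{0..<int q}. (2 * real q powr (3 / 4)) powr (p - 2) * (cmod (z k))\<^sup>2)"
    proof (intro sum_mono)
      fix k assume k: "k \<in> {0..<int q}"
      have "cmod (z k) powr p = cmod (z k) powr (p - 2) * (cmod (z k))\<^sup>2"
        by (cases "z k = 0") (auto simp flip: powr_add powr_numeral)
      also have "\<dots> \<le> (2 * real q powr (3 / 4)) powr (p - 2) * (cmod (z k))\<^sup>2"
        using z_le[OF k] p by (intro mult_right_mono powr_mono2) auto
      finally show "cmod (z k) powr p \<le> (2 * real q powr (3 / 4)) powr (p - 2) * (cmod (z k))\<^sup>2" .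
    qed
    also have "\<dots> \<le> (2 * real q powr (3 / 4)) powr (p - 2) * (real q * q)"
      unfolding sum_distrib_left[symmetric] by (intro mult_left_mono z_sum) auto
    also have "\<dots> = 2 powr (p - 2) * real q powr (3 / 4 * (p - 2) + 2)"
      using q0 by (simp add: powr_mult powr_powr powr_add power2_eq_square)
    also have "\<dots> = (q / D) powr p * E"
    proof -
      have "real q powr (3 / 4 * (p - 2) + 2) = real q powr p * real q powr (- (p - 2) / 4)"
        unfolding powr_add[symmetric] by (intro arg_cong2[where f = "(powr)"]) (auto simp: field_simps)
      then show ?thesis
        using q0 D0 by (simp add: E_def powr_divide)
    qed
    finally show ?thesis .
  qed
  have "(\<Sum>k\<in>{0..<int q}. cmod (idem q H k) powr p)
      \<le> (\<Sum>k\<in>{0..<int q}. (1 + \<epsilon>) powr p * ((q / D) powr p * F k powr p) + (1 + 1 / \<epsilon>) powr p * cmod (z k) powr p)"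
  proof (intro sum_mono)
    fix k assume k: "k \<in> {0..<int q}"
    have "cmod (idem q H k) \<le> q / D * F k + cmod (z k)"
      unfolding f[OF k] F_def[symmetric]
      using norm_triangle_ineq[of "of_real (q / D * F k)" "z k"] F0[of k] D0
      by (simp only: norm_of_real abs_of_nonneg mult_nonneg_nonneg divide_nonneg_pos of_nat_0_le_iff)
    then have "cmod (idem q H k) powr p \<le> (q / D * F k + cmod (z k)) powr p"
      using p by (intro powr_mono2) auto
    also have "\<dots> \<le> (1 + \<epsilon>) powr p * (q / D * F k) powr p + (1 + 1 / \<epsilon>) powr p * cmod (z k) powr p"
      using F0 D0 \<epsilon> p by (intro powr_add_le) auto
    finally show "cmod (idem q H k) powr p
        \<le> (1 + \<epsilon>) powr p * ((q / D) powr p * F k powr p) + (1 + 1 / \<epsilon>) powr p * cmod (z k) powr p"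
      using F0 D0 by (simp only: powr_mult[of "q / D" "F k"])
  qed
  also have "\<dots> = (1 + \<epsilon>) powr p * ((q / D) powr p * (\<Sum>k\<in>{0..<int q}. F k powr p))
      + (1 + 1 / \<epsilon>) powr p * (\<Sum>k\<in>{0..<int q}. cmod (z k) powr p)"
    by (simp add: sum.distrib sum_distrib_left)
  also have "\<dots> \<le> (1 + \<epsilon>) powr p * ((q / D) powr p * 2.48) + (1 + 1 / \<epsilon>) powr p * ((q / D) powr p * E)"
    by (intro add_mono mult_left_mono sum_F sum_z) auto
  also have "\<dots> = (q / D) powr p * X"
    by (simp add: X_def algebra_simps)
  finally have sum_f: "(\<Sum>k\<in>{0..<int q}. cmod (idem q H k) powr p) \<le> (q / D) powr p * X" .
  define Y where "Y = max 0 (cos (pi / q) ^ (2 * M) - 2 * D * real q powr (- 1 / 4))"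
  have f_1: "q / D * Y \<le> cmod (idem q H 1)"
  proof (cases "Y = 0")
    case False
    have one: "1 \<in> {0..<int q}" using q by auto
    have "q / D * (2 * D * real q powr (- 1 / 4)) = 2 * (real q powr 1 * real q powr (- 1 / 4))"
      using D0 q0 by simp
    also have "\<dots> = 2 * real q powr (3 / 4)"
      unfolding powr_add[symmetric] by simp
    finally have err: "q / D * (2 * D * real q powr (- 1 / 4)) = 2 * real q powr (3 / 4)" .
    have "Y = F 1 - 2 * D * real q powr (- 1 / 4)"
      using False unfolding Y_def F_def by (simp add: max_def split: if_splits)
    then have "q / D * Y = q / D * F 1 - 2 * real q powr (3 / 4)"
      by (simp only: right_diff_distrib err)
    also have "\<dots> \<le> cmod (of_real (q / D * F 1)) - cmod (z 1)"
    proof -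
      have "0 \<le> q / D * F 1"
        using F0[of 1] D0 by simp
      then have "cmod (of_real (q / D * F 1)) = q / D * F 1"
        by (simp only: norm_of_real abs_of_nonneg)
      then show ?thesis
        using z_le[OF one] by linarith
    qed
    also have "\<dots> \<le> cmod (of_real (q / D * F 1) + z 1)"
      using norm_diff_ineq[of "of_real (q / D * F 1)" "z 1"] by simp
    also have "of_real (q / D * F 1) + z 1 = idem q H 1"
      using f[OF one] by (simp add: F_def)
    finally show ?thesis .
  qed simp
  show ?thesis
    unfolding X_def[unfolded E_def, symmetric] Y_def[symmetric]
  proof (cases "Y = 0")
    case True
    have "concentrated p q 0"
      unfolding concentrated_iff using idem_nonzero[of "{0}" q] q0 by (intro exI[of _ "{0}"]) auto
    then show "2 * Y powr p / X \<le> gamma_sharp_q p q"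
      using gamma_sharp_q_Greatest(2)[OF q0] True p by simp
  next
    case False
    then have "Y > 0" by (simp add: Y_def)
    have "H \<noteq> {}"
    proof
      assume "H = {}"
      then have "q / D * Y \<le> 0" using f_1 by (simp add: idem_def)
      moreover have "q / D * Y > 0" using q0 D0 \<open>Y > 0\<close> by simp
      ultimately show False by simp
    qed
    then show "2 * Y powr p / X \<le> gamma_sharp_q p q"
    proof (intro gamma_sharp_q_ge[OF q0 H])
      have "2 * Y powr p / X * (\<Sum>k\<in>{0..<int q}. cmod (idem q H k) powr p) \<le> 2 * Y powr p / X * ((q / D) powr p * X)"
        using X0 by (intro mult_left_mono sum_f) auto
      also have "\<dots> = 2 * (q / D * Y) powr p"
        unfolding powr_mult[of "q / D" Y] using X0 by simp
      also have "\<dots> \<le> 2 * cmod (idem q H 1) powr p"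
        using f_1 p \<open>Y > 0\<close> D0 by (intro mult_left_mono powr_mono2) auto
      finally show "2 * Y powr p / X * (\<Sum>k\<in>{0..<int q}. cmod (idem q H k) powr p) \<le> 2 * cmod (idem q H 1) powr p" .
    qed
  qed
qed

text \<open>
  For \<open>M = c q\<^sup>2\<close> steps the transform at \<open>1\<close> tends to \<open>exp (- c pi\<^sup>2) = \<rho>\<close>, and \<open>c\<close> is chosen so that
  \<open>\<rho> powr p = 3 / 5\<close>.
\<close>

theorem gamma_sharp_above_two:
  assumes p: "p > 2"
  shows "gamma_sharp p > ereal 0.483"
proof -
  define c where "c = ln (5 / 3) / (p * pi\<^sup>2)"
  have c: "c > 0" using p by (simp add: c_def)
  define \<rho> where "\<rho> = (3 / 5 :: real) powr (1 / p)"
  have \<rho>_eq: "\<rho> = exp (- (c * pi\<^sup>2))"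
    using p by (simp add: \<rho>_def c_def powr_def ln_div) (simp add: field_simps)
  define D where "D = (1 + (3 / 5) powr (1 / p)) / (1 - (3 / 5 :: real) powr (1 / p))"
  define M where "M q = nat \<lceil>c * (real q)\<^sup>2\<rceil>" for q :: nat
  \<comment> \<open>\<open>1.2 / 2.48 = 0.4838\<dots>\<close> still exceeds \<open>0.483\<close> after division by \<open>1.0005\<close>\<close>
  define \<epsilon> where "\<epsilon> = (1.0005 :: real) powr (1 / p) - 1"
  have \<epsilon>: "\<epsilon> > 0"
    using p by (simp add: \<epsilon>_def)
  have \<epsilon>_p: "(1 + \<epsilon>) powr p = 1.0005"
    using p by (simp add: \<epsilon>_def powr_powr)
  define r where "r q = 2 * max 0 (cos (pi / real q) ^ (2 * M q) - 2 * D * real q powr (- 1 / 4)) powr p /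
     ((1 + \<epsilon>) powr p * 2.48 + (1 + 1 / \<epsilon>) powr p * (2 powr (p - 2) * D powr p * real q powr (- (p - 2) / 4)))" for q
  have \<rho>_p: "\<rho> powr p = 3 / 5"
    using p by (simp add: \<rho>_def powr_powr)
  have cos_lim: "(\<lambda>q. cos (pi / real q) ^ (2 * M q)) \<longlonglongrightarrow> \<rho>"
  proof -
    have "(\<lambda>q. of_int \<lceil>c * (real q)\<^sup>2\<rceil> / (real q)\<^sup>2) \<longlonglongrightarrow> c"
      using c by real_asymp
    then have M_lim: "(\<lambda>q. real (M q) / (real q)\<^sup>2) \<longlonglongrightarrow> c"
      using c by (simp add: M_def)
    have ln_lim: "(\<lambda>q. (real q)\<^sup>2 * ln (cos (pi / real q))) \<longlonglongrightarrow> - pi\<^sup>2 / 2"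
      by real_asymp (simp add: power2_eq_square)
    have "(\<lambda>q. exp (2 * (real (M q) / (real q)\<^sup>2) * ((real q)\<^sup>2 * ln (cos (pi / real q))))) \<longlonglongrightarrow> exp (2 * c * (- pi\<^sup>2 / 2))"
      by (intro tendsto_intros M_lim ln_lim)
    also have "exp (2 * c * (- pi\<^sup>2 / 2)) = \<rho>"
      by (simp add: \<rho>_eq)
    finally show ?thesis
    proof (rule Lim_transform_eventually)
      show "\<forall>\<^sub>F q in sequentially. exp (2 * (real (M q) / (real q)\<^sup>2) * ((real q)\<^sup>2 * ln (cos (pi / real q))))
          = cos (pi / real q) ^ (2 * M q)"
        using eventually_ge_at_top[of "3 :: nat"]
      proof eventually_elim
        case (elim q)
        have "cos (pi / real q) > 0"
        proof (rule cos_gt_zero_pi)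
          have "0 < pi / real q"
            using elim by simp
          then show "- (pi / 2) < pi / real q"
            using pi_gt_zero by linarith
          show "pi / real q < pi / 2"
            using elim by (intro divide_strict_left_mono) auto
        qed
        then have "cos (pi / real q) ^ (2 * M q) = exp (ln (cos (pi / real q))) ^ (2 * M q)"
          by simp
        also have "\<dots> = exp (real (2 * M q) * ln (cos (pi / real q)))"
          by (simp only: exp_of_nat_mult)
        finally show ?case
          using elim by simp
      qed
    qed
  qed
  have neg1: "(\<lambda>q. real q powr (- 1 / 4)) \<longlonglongrightarrow> 0"
    by real_asymp
  have neg2: "(\<lambda>q. real q powr (- (p - 2) / 4)) \<longlonglongrightarrow> 0"
    using p by real_asymp
  have "r \<longlonglongrightarrow> 2 * max 0 (\<rho> - 2 * D * 0) powr p / ((1 + \<epsilon>) powr p * 2.48 + (1 + 1 / \<epsilon>) powr p * (2 powr (p - 2) * D powr p * 0))"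
    unfolding r_def using \<epsilon> p by (intro tendsto_intros cos_lim neg1 neg2) (auto simp: \<rho>_eq)
  moreover have "max 0 (\<rho> - 2 * D * 0) = \<rho>"
    by (simp add: \<rho>_eq)
  ultimately have lim: "r \<longlonglongrightarrow> 1.2 / (1.0005 * 2.48)"
    unfolding \<epsilon>_p by (simp add: \<rho>_p)
  have "r q \<le> gamma_sharp_q p q" if q: "prime q" "q \<ge> 7" for q
  proof -
    obtain m where m: "q = 2 * m + 1"
      using odd_prime_decomp[OF q(1)] q(2) by auto
    have "c * (real q)\<^sup>2 \<le> real (M q)"
      unfolding M_def by (rule of_nat_ceiling)
    then have "c \<le> real (M q) / (real q)\<^sup>2"
      using q by (simp add: field_simps)
    then have "c * pi\<^sup>2 \<le> real (M q) / (real q)\<^sup>2 * pi\<^sup>2"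
      by (intro mult_right_mono) auto
    then have "exp (- (real (M q) * pi\<^sup>2 / (real q)\<^sup>2)) \<le> \<rho>"
      unfolding \<rho>_eq by simp
    then show ?thesis
      unfolding r_def using m q by (intro gamma_sharp_q_ge_Gaussian[OF p m _ _ D_def \<epsilon>]) (auto simp: \<rho>_def)
  qed
  then have "ereal (1.2 / (1.0005 * 2.48)) \<le> gamma_sharp p"
    by (rule gamma_sharp_ge[OF _ lim])
  moreover have "ereal 0.483 < ereal (1.2 / (1.0005 * 2.48))"
    by simp
  ultimately show ?thesis
    by (rule less_le_trans[rotated])
qed

section \<open>Indicators with a small Fourier algebra norm\<close>

text \<open>
  The periodic indicator \<open>u\<close> of a set of residues, of density between \<open>c\<close> and \<open>1 - c\<close>, whose Fourier
  coefficients \<open>b\<close> have \<open>l\<^sup>1\<close> norm at most \<open>K\<close>.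
\<close>

definition indicator_expansion :: "real \<Rightarrow> real \<Rightarrow> nat \<Rightarrow> (int \<Rightarrow> real) \<Rightarrow> (int \<Rightarrow> complex) \<Rightarrow> bool" where
  "indicator_expansion K c q u b \<longleftrightarrow>
     (\<forall>x. u x = 0 \<or> u x = 1) \<and>
     (\<forall>x. complex_of_real (u x) = (\<Sum>k\<in>{0..<int q}. b k * zq_char q k x)) \<and>
     (\<Sum>k\<in>{0..<int q}. cmod (b k)) \<le> K \<and>
     c * q \<le> (\<Sum>x\<in>{0..<int q}. u x) \<and> (\<Sum>x\<in>{0..<int q}. u x) \<le> (1 - c) * q"

definition prog_mean :: "nat \<Rightarrow> int \<Rightarrow> nat \<Rightarrow> (int \<Rightarrow> real) \<Rightarrow> int \<Rightarrow> real" where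
  "prog_mean q t L u x = (\<Sum>i<L. u (x + int i * t)) / L"

definition prog_char :: "nat \<Rightarrow> int \<Rightarrow> nat \<Rightarrow> int \<Rightarrow> complex" where
  "prog_char q t L k = (\<Sum>i<L. zq_char q k t ^ i) / L"

text \<open>
  The frequencies that vary noticeably along a progression of step \<open>t\<close> and length \<open>L\<close>; all others are
  within \<open>\<eta>\<close> of a constant there.
\<close>

definition rough :: "real \<Rightarrow> nat \<Rightarrow> int \<Rightarrow> nat \<Rightarrow> int set" where
  "rough \<eta> q t L = {k\<in>{0..<int q}. real L * cmod (zq_char q k t - 1) > \<eta>}"

lemma indicator_expansion_periodic:
  assumes "indicator_expansion K c q u b" "q > 0"
  shows "u (x + int q) = u x"
proof -
  have "complex_of_real (u (x + int q)) = complex_of_real (u x)"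
    using assms zq_char_periodic[OF assms(2)] by (simp add: indicator_expansion_def)
  then show ?thesis by simp
qed

lemma indicator_expansion_bounds:
  assumes "indicator_expansion K c q u b"
  shows "0 \<le> u x" "u x \<le> 1"
  using assms unfolding indicator_expansion_def by (metis order_refl zero_le_one)+

text \<open>
  A discrete intermediate value argument. Since \<open>q\<close> is prime, \<open>x, x + t, x + 2 t, \<dots>\<close> runs through all
  residues, and each step changes the mean over the progression by at most \<open>1 / L\<close>. Starting below the
  overall density, the mean therefore hits the density up to \<open>1 / L\<close>.
\<close>

lemma exists_intermediate_mean:
  assumes u: "indicator_expansion K c q u b" and q: "prime q" and t: "\<not> int q dvd t"
    and L: "L > 0" "1 / L \<le> c / 2"
  shows "\<exists>x. c \<le> prog_mean q t L u x \<and> prog_mean q t L u x \<le> 1 - c / 2"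
proof -
  define g where "g = prog_mean q t L u"
  define \<mu> where "\<mu> = (\<Sum>x\<in>{0..<int q}. u x) / q"
  have q0: "q > 0" using q prime_gt_0_nat by blast
  have per: "u (x + int q) = u x" for x
    by (rule indicator_expansion_periodic[OF u q0])
  have \<mu>: "c \<le> \<mu>" "\<mu> \<le> 1 - c"
    using u q0 by (auto simp: indicator_expansion_def \<mu>_def field_simps)
  have shift: "(\<Sum>x\<in>{0..<int q}. u (x + y)) = (\<Sum>x\<in>{0..<int q}. u x)" for y
  proof -
    have "(\<Sum>x\<in>{0..<int q}. u (x + y)) = (\<Sum>x\<in>{y..<y + int q}. u x)"
      by (rule sum.reindex_bij_witness[of _ "\<lambda>x. x - y" "\<lambda>x. x + y"]) auto
    then show ?thesis
      using sum_periodic_window[where g = u and q = q and a = y] per by simp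
  qed
  have "(\<Sum>x\<in>{0..<int q}. g x) = (\<Sum>i<L. \<Sum>x\<in>{0..<int q}. u (x + int i * t)) / L"
    unfolding g_def prog_mean_def sum_divide_distrib[symmetric] by (subst sum.swap) simp
  also have "\<dots> = q * \<mu>"
    using L q0 by (simp add: shift \<mu>_def)
  finally have total: "(\<Sum>x\<in>{0..<int q}. g x) = (\<Sum>x\<in>{0..<int q}. \<mu>)"
    by simp
  obtain x0 where x0: "g x0 \<le> \<mu>"
  proof (rule ccontr)
    assume "\<not> thesis"
    then have "\<mu> < g x" for x using that not_le by blast
    then have "(\<Sum>x\<in>{0..<int q}. \<mu>) < (\<Sum>x\<in>{0..<int q}. g x)"
      using q0 by (intro sum_strict_mono) auto
    then show False using total by simp
  qed
  obtain x1 where x1: "\<mu> \<le> g x1"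
  proof (rule ccontr)
    assume "\<not> thesis"
    then have "g x < \<mu>" for x using that not_le by blast
    then have "(\<Sum>x\<in>{0..<int q}. g x) < (\<Sum>x\<in>{0..<int q}. \<mu>)"
      using q0 by (intro sum_strict_mono) auto
    then show False using total by simp
  qed
  have u_cong: "u x = u y" if "int q dvd x - y" for x y
  proof -
    have "complex_of_real (u x) = complex_of_real (u y)"
      using u zq_char_cong[OF q0 that]
      by (simp add: indicator_expansion_def zq_char_commute[of q _ x] zq_char_commute[of q _ y])
    then show ?thesis by simp
  qed
  have "coprime (int q) t"
    using q t by (simp add: prime_imp_coprime)
  then obtain s where s: "[t * s = 1] (mod int q)"
    by (metis cong_solve_coprime_int coprime_commute)
  define n where "n = nat ((s * (x1 - x0)) mod int q)"
  have "[int n * t = (s * (x1 - x0)) * t] (mod int q)"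
    unfolding n_def using q0 by (intro cong_mult) (auto simp: cong_def)
  also have "[(s * (x1 - x0)) * t = 1 * (x1 - x0)] (mod int q)"
    using cong_mult[OF s cong_refl, of "x1 - x0"] by (simp add: mult_ac)
  finally have n: "int q dvd (x0 + int n * t) - x1"
    by (simp add: cong_iff_dvd_diff algebra_simps)
  have "g (x0 + int n * t) = g x1"
    unfolding g_def prog_mean_def
    by (intro arg_cong2[where f = "(/)"] sum.cong refl u_cong) (use n in \<open>simp add: algebra_simps\<close>)
  then have ex: "\<exists>n. \<mu> \<le> g (x0 + int n * t)"
    using x1 by metis
  \<comment> \<open>the first point of the walk where the mean reaches the density\<close>
  define j where "j = (LEAST n. \<mu> \<le> g (x0 + int n * t))"
  have j: "\<mu> \<le> g (x0 + int j * t)"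
    unfolding j_def by (rule LeastI_ex[OF ex])
  have step: "g (x + t) \<le> g x + 1 / L" for x
  proof -
    have "(\<Sum>i<L. u (x + t + int i * t)) - (\<Sum>i<L. u (x + int i * t)) = u (x + int L * t) - u x"
      unfolding sum_subtractf[symmetric]
      using sum_lessThan_telescope[of "\<lambda>i. u (x + int i * t)" L] by (simp add: algebra_simps)
    also have "\<dots> \<le> 1"
      using indicator_expansion_bounds[OF u] by (smt (verit))
    finally have "(\<Sum>i<L. u (x + t + int i * t)) \<le> (\<Sum>i<L. u (x + int i * t)) + 1"
      by simp
    then show ?thesis
      using L by (simp add: g_def prog_mean_def field_simps)
  qed
  have "g (x0 + int j * t) \<le> \<mu> + 1 / L"
  proof (cases j)
    case 0
    then show ?thesis using x0 by (simp add: add_increasing2)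
  next
    case (Suc i)
    then have "g (x0 + int i * t) < \<mu>"
      using not_less_Least[of i "\<lambda>n. \<mu> \<le> g (x0 + int n * t)"] by (simp add: j_def)
    then show ?thesis
      using step[of "x0 + int i * t"] by (simp add: Suc algebra_simps)
  qed
  then show ?thesis
    using j \<mu> L unfolding g_def by (intro exI[of _ "x0 + int j * t"]) linarith
qed

lemma norm_prog_char_le: "L > 0 \<Longrightarrow> cmod (prog_char q t L k) \<le> 1"
proof -
  assume "L > 0"
  moreover have "cmod (\<Sum>i<L. zq_char q k t ^ i) \<le> (\<Sum>i<L. 1)"
    by (intro sum_norm_le) (simp add: norm_power)
  ultimately show ?thesis
    by (simp add: prog_char_def norm_divide)
qed

text \<open>
  The geometric sum of length \<open>L\<close> is bounded by \<open>2 / |z - 1|\<close>, so it can only be large if \<open>z\<close> is very close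
  to \<open>1\<close>.
\<close>

lemma large_prog_char:
  assumes "\<eta> \<le> cmod (prog_char q t L m)" "\<eta> > 0" "L > 0"
  shows "cmod (zq_char q m t - 1) \<le> 2 / (\<eta> * L)"
proof -
  let ?z = "zq_char q m t"
  have "L * cmod (prog_char q t L m) * cmod (?z - 1) = cmod (?z ^ L - 1)"
    using assms(3) unfolding prog_char_def
    by (simp add: norm_divide power_diff_1_eq norm_mult mult_ac)
  also have "\<dots> \<le> 2"
    using norm_triangle_ineq4[of "?z ^ L" 1] by (simp add: norm_power)
  finally have "L * cmod (prog_char q t L m) * cmod (?z - 1) \<le> 2" .
  moreover have "L * \<eta> * cmod (?z - 1) \<le> L * cmod (prog_char q t L m) * cmod (?z - 1)"
    using assms by (intro mult_right_mono mult_left_mono) auto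
  ultimately have "L * \<eta> * cmod (?z - 1) \<le> 2"
    by linarith
  then show ?thesis
    using assms by (simp add: field_simps)
qed

lemma smooth_power:
  assumes "k \<in> {0..<int q} - rough \<eta> q t L" "i < L"
  shows "cmod (zq_char q k t ^ i - 1) \<le> \<eta>"
proof -
  have "cmod (zq_char q k t ^ i - 1) \<le> i * cmod (zq_char q k t - 1)"
    using norm_power_diff[of "zq_char q k t" 1 i] by simp
  also have "\<dots> \<le> L * cmod (zq_char q k t - 1)"
    using assms by (intro mult_right_mono) auto
  also have "\<dots> \<le> \<eta>"
    using assms by (auto simp: rough_def)
  finally show ?thesis .
qed

lemma smooth_prog_char:
  assumes "k \<in> {0..<int q} - rough \<eta> q t L" "L > 0"
  shows "cmod (prog_char q t L k - 1) \<le> \<eta>"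
proof -
  have eq: "prog_char q t L k - 1 = (\<Sum>i<L. zq_char q k t ^ i - 1) / L"
    using assms by (simp add: prog_char_def sum_subtractf diff_divide_distrib)
  have "cmod (\<Sum>i<L. zq_char q k t ^ i - 1) \<le> (\<Sum>i<L. \<eta>)"
    by (intro sum_norm_le) (use smooth_power[OF assms(1)] in auto)
  then show ?thesis
    unfolding eq using assms by (simp add: norm_divide field_simps)
qed

text \<open>
  On a progression with intermediate mean \<open>g\<close> the function \<open>h = u - g\<close> has sum zero and correlates with
  \<open>u\<close> by the variance \<open>g (1 - g)\<close>. Expanding \<open>u\<close>, some single character \<open>m\<close> must correlate
  with \<open>h\<close>. Expanding \<open>h\<close> in turn, the frequency \<open>k\<close> contributes to this correlation \<open>b k\<close> times
  \<open>D (m + k) - D m D k\<close>, where \<open>D\<close> is the mean of a character over the progression. This is small if \<open>k\<close> is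
  almost constant on the progression, and also if \<open>D k\<close> and \<open>D (m + k)\<close> are both small; the remaining
  frequencies form the cluster.
\<close>

lemma exists_rough_cluster:
  assumes u: "indicator_expansion K c q u b" and q: "prime q" and t: "\<not> int q dvd t"
    and L: "L > 0" "1 / L \<le> c / 2" and K: "K \<ge> 1" and c: "c > 0" and \<eta>: "\<eta> = c\<^sup>2 / (16 * K\<^sup>2)"
  shows "\<exists>m. c\<^sup>2 / (16 * K) \<le>
    (\<Sum>k\<in>{k\<in>rough \<eta> q t L. \<eta> \<le> cmod (prog_char q t L k) \<or> \<eta> \<le> cmod (prog_char q t L (m + k))}. cmod (b k))"
proof -
  obtain x where x: "c \<le> prog_mean q t L u x" "prog_mean q t L u x \<le> 1 - c / 2"
    using exists_intermediate_mean[OF u q t L] by blast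
  define g where "g = prog_mean q t L u x"
  define v where "v = c\<^sup>2 / 2"
  define z where "z k = zq_char q k t" for k
  define D where "D = prog_char q t L"
  define h where "h i = u (x + int i * t) - g" for i :: nat
  \<comment> \<open>the correlation of \<open>h\<close> with the character \<open>k\<close> along the progression\<close>
  define T where "T k = (\<Sum>i<L. z k ^ i * h i)" for k
  have K_bd: "(\<Sum>k\<in>{0..<int q}. cmod (b k)) \<le> K"
    using u by (simp add: indicator_expansion_def)
  have v0: "v > 0" using c by (simp add: v_def)
  have \<eta>0: "\<eta> > 0" using c K by (simp add: \<eta>)
  have norm_z [simp]: "cmod (z k) = 1" for k
    by (simp add: z_def)
  have u_exp: "complex_of_real (u (x + int i * t)) = (\<Sum>k\<in>{0..<int q}. b k * zq_char q k x * z k ^ i)" for i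
  proof -
    have "zq_char q k (int i * t) = z k ^ i" for k
      using zq_char_power[of q i t k] by (simp add: z_def zq_char_commute[of q k])
    then show ?thesis
      using u by (simp add: indicator_expansion_def zq_char_add_right mult_ac)
  qed
  have sum_h: "(\<Sum>i<L. h i) = 0"
    using L by (simp add: h_def sum_subtractf g_def prog_mean_def)
  have "c * (c / 2) \<le> g * (1 - g)"
    using x c unfolding g_def by (intro mult_mono) auto
  moreover have "L * (g * (1 - g)) = (\<Sum>i<L. u (x + int i * t) * h i)"
  proof -
    have "(\<Sum>i<L. u (x + int i * t) * h i) = (\<Sum>i<L. (1 - g) * u (x + int i * t))"
    proof (intro sum.cong refl)
      fix i
      have "u (x + int i * t) = 0 \<or> u (x + int i * t) = 1"
        using u by (simp add: indicator_expansion_def)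
      then show "u (x + int i * t) * h i = (1 - g) * u (x + int i * t)"
        by (auto simp: h_def)
    qed
    then show ?thesis
      using L by (simp add: sum_distrib_left[symmetric] g_def prog_mean_def)
  qed
  ultimately have variance: "L * v \<le> (\<Sum>i<L. u (x + int i * t) * h i)"
    using L by (metis mult.commute mult_left_mono of_nat_0_le_iff power2_eq_square times_divide_eq_right v_def)
  have "complex_of_real (\<Sum>i<L. u (x + int i * t) * h i)
      = (\<Sum>i<L. \<Sum>k\<in>{0..<int q}. b k * zq_char q k x * (z k ^ i * h i))"
    unfolding of_real_sum of_real_mult u_exp sum_distrib_right by (simp add: mult_ac)
  also have "\<dots> = (\<Sum>k\<in>{0..<int q}. b k * zq_char q k x * T k)"
    by (subst sum.swap) (simp add: T_def sum_distrib_left)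
  finally have expand: "complex_of_real (\<Sum>i<L. u (x + int i * t) * h i)
      = (\<Sum>k\<in>{0..<int q}. b k * zq_char q k x * T k)" .
  have "L * v \<le> \<bar>\<Sum>i<L. u (x + int i * t) * h i\<bar>"
    using variance by linarith
  also have "\<dots> = cmod (complex_of_real (\<Sum>i<L. u (x + int i * t) * h i))"
    by (simp only: norm_of_real)
  also have "\<dots> \<le> (\<Sum>k\<in>{0..<int q}. cmod (b k) * cmod (T k))"
    unfolding expand by (intro sum_norm_le) (simp add: norm_mult)
  finally have correlation: "L * v \<le> (\<Sum>k\<in>{0..<int q}. cmod (b k) * cmod (T k))" .
  obtain m where m: "L * v / (2 * K) \<le> cmod (T m)"
  proof (rule ccontr)
    assume "\<not> thesis"
    then have "cmod (T k) \<le> L * v / (2 * K)" for k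
      using that by (meson linear)
    then have "(\<Sum>k\<in>{0..<int q}. cmod (b k) * cmod (T k)) \<le> (\<Sum>k\<in>{0..<int q}. cmod (b k)) * (L * v / (2 * K))"
      unfolding sum_distrib_right by (intro sum_mono mult_left_mono) auto
    also have "\<dots> \<le> K * (L * v / (2 * K))"
      using K_bd v0 K by (intro mult_right_mono) auto
    also have "\<dots> = L * v / 2"
      using K by simp
    also have "\<dots> < L * v"
      using v0 L by simp
    finally show False using correlation by simp
  qed
  define N where "N = {k\<in>rough \<eta> q t L. \<eta> \<le> cmod (D k) \<or> \<eta> \<le> cmod (D (m + k))}"
  have D_eq: "L * D k = (\<Sum>i<L. z k ^ i)" for k
    using L by (simp add: D_def prog_char_def z_def)
  have g_exp: "complex_of_real g = (\<Sum>k\<in>{0..<int q}. b k * zq_char q k x * D k)"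
  proof -
    have "complex_of_real (L * g) = (\<Sum>i<L. \<Sum>k\<in>{0..<int q}. b k * zq_char q k x * z k ^ i)"
      using L by (simp add: g_def prog_mean_def u_exp)
    also have "\<dots> = (\<Sum>k\<in>{0..<int q}. b k * zq_char q k x * (L * D k))"
      by (subst sum.swap) (simp add: D_eq sum_distrib_left)
    also have "\<dots> = L * (\<Sum>k\<in>{0..<int q}. b k * zq_char q k x * D k)"
      by (simp add: sum_distrib_left mult_ac)
    finally show ?thesis using L by simp
  qed
  \<comment> \<open>the contribution of the frequency \<open>k\<close> to \<open>T m\<close>\<close>
  define B where "B k = (\<Sum>i<L. z m ^ i * (z k ^ i - D k))" for k
  have B_eq: "B k = L * (D (m + k) - D m * D k)" for k
  proof -
    have "z (m + k) = z m * z k"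
      by (simp add: z_def zq_char_add_left)
    then show ?thesis
      by (simp add: B_def right_diff_distrib D_eq sum_subtractf power_mult_distrib
          sum_distrib_right[symmetric] mult.assoc[symmetric])
  qed
  have "T m = (\<Sum>i<L. \<Sum>k\<in>{0..<int q}. b k * zq_char q k x * (z m ^ i * (z k ^ i - D k)))"
    unfolding T_def
  proof (intro sum.cong refl)
    fix i
    have "complex_of_real (h i) = (\<Sum>k\<in>{0..<int q}. b k * zq_char q k x * (z k ^ i - D k))"
      by (simp add: h_def u_exp g_exp sum_subtractf right_diff_distrib)
    then show "z m ^ i * complex_of_real (h i) = (\<Sum>k\<in>{0..<int q}. b k * zq_char q k x * (z m ^ i * (z k ^ i - D k)))"
      by (simp add: sum_distrib_left mult_ac)
  qed
  also have "\<dots> = (\<Sum>k\<in>{0..<int q}. b k * zq_char q k x * B k)"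
    by (subst sum.swap) (simp add: B_def sum_distrib_left)
  finally have "cmod (T m) \<le> (\<Sum>k\<in>{0..<int q}. cmod (b k) * cmod (B k))"
    by (auto intro!: sum_norm_le simp: norm_mult)
  also have "\<dots> \<le> (\<Sum>k\<in>{0..<int q}. cmod (b k) * (real L * 2 * \<eta>) + (if k \<in> N then cmod (b k) * (real L * 2) else 0))"
  proof (intro sum_mono)
    fix k assume k: "k \<in> {0..<int q}"
    show "cmod (b k) * cmod (B k) \<le> cmod (b k) * (real L * 2 * \<eta>) + (if k \<in> N then cmod (b k) * (real L * 2) else 0)"
    proof (cases "k \<in> rough \<eta> q t L")
      case False
      have "cmod (B k) \<le> (\<Sum>i<L. 2 * \<eta>)"
        unfolding B_def
      proof (intro sum_norm_le)
        fix i assume "i \<in> {..<L}"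
        then have "cmod (z k ^ i - 1) \<le> \<eta>" "cmod (D k - 1) \<le> \<eta>"
          using smooth_power[of k q \<eta> t L i] smooth_prog_char[of k q \<eta> t L] False k L
          by (auto simp: z_def D_def)
        then have "cmod (z k ^ i - D k) \<le> 2 * \<eta>"
          using norm_triangle_ineq4[of "z k ^ i - 1" "D k - 1"] by simp
        then show "cmod (z m ^ i * (z k ^ i - D k)) \<le> 2 * \<eta>"
          by (simp add: norm_mult norm_power)
      qed
      then have "cmod (b k) * cmod (B k) \<le> cmod (b k) * (real L * 2 * \<eta>)"
        by (intro mult_left_mono) auto
      then show ?thesis using False by (simp add: N_def)
    next
      case True
      have Dm: "cmod (D j) \<le> 1" for j
        unfolding D_def by (rule norm_prog_char_le[OF L(1)])
      have B_le: "cmod (B k) \<le> L * (cmod (D (m + k)) + cmod (D k))"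
      proof -
        have "cmod (D m * D k) \<le> cmod (D k)"
          using Dm[of m] by (simp add: norm_mult mult_left_le_one_le)
        then have "cmod (D (m + k) - D m * D k) \<le> cmod (D (m + k)) + cmod (D k)"
          using norm_triangle_ineq4[of "D (m + k)" "D m * D k"] by linarith
        then show ?thesis
          unfolding B_eq norm_mult by (simp add: mult_left_mono)
      qed
      show ?thesis
      proof (cases "k \<in> N")
        case kN: True
        have "L * (cmod (D (m + k)) + cmod (D k)) \<le> real L * 2"
          using Dm[of "m + k"] Dm[of k] by (intro mult_left_mono) auto
        then have "cmod (b k) * cmod (B k) \<le> cmod (b k) * (real L * 2)"
          using B_le by (intro mult_left_mono) auto
        moreover have "0 \<le> cmod (b k) * (real L * 2 * \<eta>)"
          using \<eta>0 by simp
        ultimately show ?thesis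
          using kN by (simp only: if_True)
      next
        case kN: False
        then have "L * (cmod (D (m + k)) + cmod (D k)) \<le> L * (2 * \<eta>)"
          using True by (intro mult_left_mono) (auto simp: N_def)
        then have "cmod (b k) * cmod (B k) \<le> cmod (b k) * (L * (2 * \<eta>))"
          using B_le by (intro mult_left_mono) auto
        then show ?thesis
          using kN by (simp add: mult_ac)
      qed
    qed
  qed
  also have "\<dots> = (\<Sum>k\<in>{0..<int q}. cmod (b k)) * (real L * 2 * \<eta>) + (\<Sum>k\<in>{0..<int q} \<inter> N. cmod (b k) * (real L * 2))"
    by (simp add: sum.distrib sum_distrib_right sum.inter_restrict)
  also have "{0..<int q} \<inter> N = N"
    by (auto simp: N_def rough_def)
  also have "(\<Sum>k\<in>N. cmod (b k) * (real L * 2)) = real L * 2 * (\<Sum>k\<in>N. cmod (b k))"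
    by (simp add: sum_distrib_left mult_ac)
  finally have "cmod (T m) \<le> (\<Sum>k\<in>{0..<int q}. cmod (b k)) * (real L * 2 * \<eta>) + real L * 2 * (\<Sum>k\<in>N. cmod (b k))" .
  also have "\<dots> \<le> K * (real L * 2 * \<eta>) + real L * 2 * (\<Sum>k\<in>N. cmod (b k))"
    using K_bd \<eta>0 by (intro add_right_mono mult_right_mono) auto
  finally have "L * (v / (2 * K)) \<le> L * (2 * (K * \<eta> + (\<Sum>k\<in>N. cmod (b k))))"
    using m by (simp add: algebra_simps)
  then have ineq: "v / (2 * K) \<le> 2 * (K * \<eta> + (\<Sum>k\<in>N. cmod (b k)))"
    using L by (simp only: mult_le_cancel_left_pos of_nat_0_less_iff)
  define w where "w = v / (8 * K)"
  have w1: "K * \<eta> = w"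
    using K by (simp add: \<eta> v_def w_def power2_eq_square)
  have w2: "v / (2 * K) = 4 * w"
    by (simp add: w_def)
  have "w \<le> (\<Sum>k\<in>N. cmod (b k))"
    using ineq unfolding w1 w2 distrib_left by simp
  then show ?thesis
    unfolding N_def D_def v_def w_def by (intro exI[of _ m]) simp
qed

lemma norm_zq_char_minus_1_mult:
  "cmod (zq_char q k (int s * t) - 1) \<le> s * cmod (zq_char q k t - 1)"
proof -
  have "zq_char q k (int s * t) = zq_char q k t ^ s"
    using zq_char_power[of q s t k] by (simp add: zq_char_commute[of q k])
  then show ?thesis
    using norm_power_diff[of "zq_char q k t" 1 s] by simp
qed

lemma norm_zq_char_minus_1_le:
  assumes "\<bar>of_int h * of_int x / real q - of_int n\<bar> \<le> r"
  shows "cmod (zq_char q h x - 1) \<le> 2 * pi * r"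
proof -
  have "\<bar>sin (pi * (y - of_int n))\<bar> = \<bar>sin (pi * y)\<bar>" for y
    unfolding right_diff_distrib sin_diff by (simp add: abs_mult)
  from this[of "of_int h * of_int x / real q"]
  have "\<bar>sin (pi * of_int h * of_int x / q)\<bar> = \<bar>sin (pi * (of_int h * of_int x / real q - of_int n))\<bar>"
    by (simp add: mult.assoc)
  also have "\<dots> \<le> \<bar>pi * (of_int h * of_int x / real q - of_int n)\<bar>"
    by (rule abs_sin_x_le_abs_x)
  also have "\<dots> \<le> pi * r"
    using assms by (simp add: abs_mult)
  finally show ?thesis
    by (simp add: norm_zq_char_minus_1)
qed

lemma exists_multiplier:
  assumes "N > 0"
  shows "\<exists>s. 0 < s \<and> s \<le> N \<and> cmod (zq_char q m (int s * t) - 1) \<le> 2 * pi / N"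
proof -
  obtain a s where s: "0 < s" "s \<le> int N" "\<bar>of_int s * (of_int m * of_int t / real q) - of_int a\<bar> < 1 / N"
    using Dirichlet_approx[OF assms] by metis
  then have "cmod (zq_char q m (int (nat s) * t) - 1) \<le> 2 * pi * (1 / N)"
    by (intro norm_zq_char_minus_1_le[where n = a]) (simp add: mult_ac)
  then show ?thesis
    using s by (intro exI[of _ "nat s"]) auto
qed

text \<open>
  The lengths and steps are chosen so that \<open>L\<close> is large compared with \<open>N\<close>, and \<open>N\<close> large compared with
  \<open>L'\<close>. By Dirichlet's theorem some \<open>s \<le> N\<close> makes the frequency \<open>m\<close> almost constant along
  progressions of step \<open>s t\<close> and length \<open>L'\<close>. Then so are all frequencies of the cluster belonging to \<open>m\<close>,
  while \<open>s L' \<le> L\<close> keeps those smooth that already were. Hence the mass of the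
  cluster is disjoint from the mass that the induction hypothesis provides for step \<open>s t\<close>. It is
  essential that the hypothesis holds for all steps, and that \<open>L\<close> and \<open>Q\<close> do not depend on them.
\<close>

lemma rough_mass:
  assumes K: "K \<ge> 1" and c: "c > 0" and \<eta>: "\<eta> = c\<^sup>2 / (16 * K\<^sup>2)"
  shows "\<exists>L Q. 1 / real L \<le> c / 2 \<and> L > 0 \<and> (\<forall>q t u b. prime q \<longrightarrow> q > Q \<longrightarrow> \<not> int q dvd t \<longrightarrow>
    indicator_expansion K c q u b \<longrightarrow> real n * (c\<^sup>2 / (16 * K)) \<le> (\<Sum>k\<in>rough \<eta> q t L. cmod (b k)))"
proof (induction n)
  case 0
  obtain L :: nat where L: "L > 2 / c"
    using reals_Archimedean2 by blast
  moreover have "2 / c > 0"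
    using c by simp
  ultimately have L0: "real L > 0"
    by linarith
  then have "L > 0" "1 / real L \<le> c / 2"
    using L c by (auto simp: field_simps)
  then show ?case
    by (intro exI[of _ L]) (auto intro: sum_nonneg)
next
  case (Suc n)
  then obtain L' Q where L': "1 / real L' \<le> c / 2" "L' > 0"
    and IH: "\<And>q t u b. prime q \<Longrightarrow> q > Q \<Longrightarrow> \<not> int q dvd t \<Longrightarrow> indicator_expansion K c q u b \<Longrightarrow>
      n * (c\<^sup>2 / (16 * K)) \<le> (\<Sum>k\<in>rough \<eta> q t L'. cmod (b k))"
    by blast
  have \<eta>0: "\<eta> > 0" using c K by (simp add: \<eta>)
  obtain N :: nat where N: "N > 4 * pi * L' / \<eta>"
    using reals_Archimedean2 by blast
  have "4 * pi * L' / \<eta> \<ge> 0" using \<eta>0 by simp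
  then have N0: "N > 0" using N by (intro gr0I) auto
  obtain L :: nat where L: "L > L' * N + 4 * N * L' / \<eta>\<^sup>2"
    using reals_Archimedean2 by blast
  have "4 * N * L' / \<eta>\<^sup>2 \<ge> 0" "real (L' * N) \<ge> 0" by auto
  then have LN: "real L \<ge> real (L' * N)" and L4: "L \<ge> 4 * N * L' / \<eta>\<^sup>2"
    using L by linarith+
  have LL': "L \<ge> L'"
  proof -
    have "L' * 1 \<le> L' * N" using N0 by (intro mult_left_mono) auto
    also have "\<dots> \<le> L" using LN by (simp only: of_nat_le_iff)
    finally show ?thesis by simp
  qed
  then have L0: "L > 0" using L' by simp
  have Lc: "1 / real L \<le> c / 2"
    using LL' L' by (intro order_trans[OF _ L'(1)] divide_left_mono) auto
  show ?case
  proof (rule exI[of _ L], rule exI[of _ "Q + N"], intro conjI allI impI Lc L0)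
    fix q t u b
    assume q: "prime q" "q > Q + N" and t: "\<not> int q dvd t" and u: "indicator_expansion K c q u b"
    obtain m where m: "c\<^sup>2 / (16 * K) \<le>
        (\<Sum>k\<in>{k\<in>rough \<eta> q t L. \<eta> \<le> cmod (prog_char q t L k) \<or> \<eta> \<le> cmod (prog_char q t L (m + k))}. cmod (b k))"
      (is "_ \<le> (\<Sum>k\<in>?N. _)")
      using exists_rough_cluster[OF u q(1) t L0 Lc K c \<eta>] by blast
    obtain s where s: "0 < s" "s \<le> N" "cmod (zq_char q m (int s * t) - 1) \<le> 2 * pi / N"
      using exists_multiplier[OF N0] by blast
    have "\<not> int q dvd int s"
      using s q by (auto dest: dvd_imp_le)
    then have st: "\<not> int q dvd int s * t"
      using t q(1) by (simp add: prime_dvd_mult_iff)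
    have sub: "rough \<eta> q (int s * t) L' \<subseteq> rough \<eta> q t L"
    proof
      fix k assume k: "k \<in> rough \<eta> q (int s * t) L'"
      have "\<eta> < L' * cmod (zq_char q k (int s * t) - 1)"
        using k by (simp add: rough_def)
      also have "\<dots> \<le> L' * (N * cmod (zq_char q k t - 1))"
        using s by (intro mult_left_mono order_trans[OF norm_zq_char_minus_1_mult] mult_right_mono) auto
      also have "\<dots> \<le> L * cmod (zq_char q k t - 1)"
        unfolding mult.assoc[symmetric] using LN by (intro mult_right_mono) auto
      finally show "k \<in> rough \<eta> q t L"
        using k by (simp add: rough_def)
    qed
    have disj: "rough \<eta> q (int s * t) L' \<inter> ?N = {}"
    proof (rule ccontr)
      assume "rough \<eta> q (int s * t) L' \<inter> ?N \<noteq> {}"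
      then obtain k where k: "k \<in> rough \<eta> q (int s * t) L'"
        and "\<eta> \<le> cmod (prog_char q t L k) \<or> \<eta> \<le> cmod (prog_char q t L (m + k))"
        by blast
      \<comment> \<open>the frequency of the pair \<open>k\<close>, \<open>m + k\<close> with the large mean\<close>
      then obtain j where j: "\<eta> \<le> cmod (prog_char q t L j)" "j = k \<or> j = m + k"
        by blast
      have "cmod (zq_char q j (int s * t) - 1) \<le> N * (2 / (\<eta> * L))"
        using s large_prog_char[OF j(1) \<eta>0 L0]
        by (intro order_trans[OF norm_zq_char_minus_1_mult] mult_mono) auto
      moreover have "L' * (N * (2 / (\<eta> * L))) \<le> \<eta> / 2"
        using L4 \<eta>0 L0 by (simp add: field_simps power2_eq_square)
      ultimately have j_le: "L' * cmod (zq_char q j (int s * t) - 1) \<le> \<eta> / 2"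
        by (meson mult_left_mono of_nat_0_le_iff order_trans)
      have "L' * (2 * pi / N) \<le> \<eta> / 2"
        using N \<eta>0 N0 by (simp add: field_simps)
      then have m_le: "L' * cmod (zq_char q m (int s * t) - 1) \<le> \<eta> / 2"
        using s(3) by (meson mult_left_mono of_nat_0_le_iff order_trans)
      have "cmod (zq_char q k (int s * t) - 1)
          \<le> cmod (zq_char q j (int s * t) - 1) + cmod (zq_char q m (int s * t) - 1)"
      proof (cases "j = k")
        case False
        then have "zq_char q j (int s * t) = zq_char q m (int s * t) * zq_char q k (int s * t)"
          using j(2) by (simp add: zq_char_add_left)
        then have "cmod (zq_char q j (int s * t) - zq_char q m (int s * t)) = cmod (zq_char q k (int s * t) - 1)"
          by (metis mult.right_neutral mult_1 norm_mult norm_zq_char right_diff_distrib)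
        then show ?thesis
          using norm_triangle_ineq4[of "zq_char q j (int s * t) - 1" "zq_char q m (int s * t) - 1"] by simp
      qed simp
      then have "L' * cmod (zq_char q k (int s * t) - 1)
          \<le> L' * (cmod (zq_char q j (int s * t) - 1) + cmod (zq_char q m (int s * t) - 1))"
        by (intro mult_left_mono) auto
      also have "\<dots> \<le> \<eta>"
        using j_le m_le by (simp add: distrib_left)
      finally show False
        using k by (simp add: rough_def)
    qed
    have fin: "finite (rough \<eta> q t L)"
      by (rule finite_subset[of _ "{0..<int q}"]) (auto simp: rough_def)
    have "real (Suc n) * (c\<^sup>2 / (16 * K))
        \<le> (\<Sum>k\<in>rough \<eta> q (int s * t) L'. cmod (b k)) + (\<Sum>k\<in>?N. cmod (b k))"
      using add_mono[OF IH[OF q(1) _ st u] m] q(2) by (simp add: add_divide_distrib distrib_right)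
    also have "\<dots> = (\<Sum>k\<in>rough \<eta> q (int s * t) L' \<union> ?N. cmod (b k))"
      using fin sub by (intro sum.union_disjoint[symmetric] disj) (auto intro: finite_subset)
    also have "\<dots> \<le> (\<Sum>k\<in>rough \<eta> q t L. cmod (b k))"
      using fin sub by (intro sum_mono2) auto
    finally show "real (Suc n) * (c\<^sup>2 / (16 * K)) \<le> (\<Sum>k\<in>rough \<eta> q t L. cmod (b k))" .
  qed
qed

lemma no_indicator_expansion:
  assumes K: "K \<ge> 1" and c: "c > 0"
  shows "\<exists>Q. \<forall>q u b. prime q \<longrightarrow> q > Q \<longrightarrow> \<not> indicator_expansion K c q u b"
proof -
  define \<eta> where "\<eta> = c\<^sup>2 / (16 * K\<^sup>2)"
  obtain n :: nat where n: "n > K / (c\<^sup>2 / (16 * K))"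
    using reals_Archimedean2 by blast
  obtain L Q where LQ: "\<And>q t u b. prime q \<Longrightarrow> q > Q \<Longrightarrow> \<not> int q dvd t \<Longrightarrow>
      indicator_expansion K c q u b \<Longrightarrow> n * (c\<^sup>2 / (16 * K)) \<le> (\<Sum>k\<in>rough \<eta> q t L. cmod (b k))"
    using rough_mass[OF K c \<eta>_def, of n] by blast
  have "\<not> indicator_expansion K c q u b" if q: "prime q" "q > Q" for q u b
  proof
    assume u: "indicator_expansion K c q u b"
    have "\<not> int q dvd 1"
      using q prime_gt_1_nat[of q] by auto
    then have "n * (c\<^sup>2 / (16 * K)) \<le> (\<Sum>k\<in>rough \<eta> q 1 L. cmod (b k))"
      by (rule LQ[OF q _ u])
    also have "\<dots> \<le> (\<Sum>k\<in>{0..<int q}. cmod (b k))"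
      by (rule sum_mono2) (auto simp: rough_def)
    also have "\<dots> \<le> K"
      using u by (simp add: indicator_expansion_def)
    also have "K < n * (c\<^sup>2 / (16 * K))"
      using n K c by (simp add: field_simps)
    finally show False by simp
  qed
  then show ?thesis by blast
qed

section \<open>No uniform concentration for small exponents\<close>

lemma indicator_expansion_set:
  fixes K c :: real
  assumes q: "q > 0" and H: "H \<subseteq> {0..<int q}"
    and f: "f = idem q H"
    and K: "(\<Sum>k\<in>{0..<int q}. cmod (f k)) \<le> K * q" and c: "c * q \<le> card H" "card H \<le> (1 - c) * q"
  shows "indicator_expansion K c q (\<lambda>x. of_bool (x mod int q \<in> H)) (\<lambda>k. cnj (f k) / q)"
proof -
  have fin: "finite H" using H finite_subset by blast
  have "complex_of_real (of_bool (x mod int q \<in> H)) = (\<Sum>k\<in>{0..<int q}. cnj (f k) / of_nat q * zq_char q k x)" for x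
  proof -
    have "(\<Sum>k\<in>{0..<int q}. cnj (f k) * zq_char q k x)
        = (\<Sum>k\<in>{0..<int q}. \<Sum>h\<in>H. zq_char q (x - h) k)"
      by (simp add: f idem_def sum_distrib_left zq_char_diff_left zq_char_commute[of q _ x] mult_ac)
    also have "\<dots> = (\<Sum>h\<in>H. \<Sum>k\<in>{0..<int q}. zq_char q (x - h) k)"
      by (rule sum.swap)
    also have "\<dots> = (\<Sum>h\<in>H. if x mod int q = h then of_nat q else 0)"
    proof (intro sum.cong refl)
      fix h assume "h \<in> H"
      then have "h mod int q = h" using H by auto
      then have "int q dvd x - h \<longleftrightarrow> x mod int q = h"
        by (metis mod_eq_dvd_iff)
      then show "(\<Sum>k\<in>{0..<int q}. zq_char q (x - h) k) = (if x mod int q = h then of_nat q else 0)"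
        by (simp add: sum_zq_char[OF q])
    qed
    also have "\<dots> = (if x mod int q \<in> H then of_nat q else 0)"
      using fin by simp
    finally show ?thesis
      using q by (simp add: sum_divide_distrib[symmetric] times_divide_eq_left)
  qed
  moreover have "(\<Sum>x\<in>{0..<int q}. of_bool (x mod int q \<in> H)) = real (card H)"
  proof -
    have "(\<Sum>x\<in>{0..<int q}. of_bool (x mod int q \<in> H)) = (\<Sum>x\<in>{0..<int q}. if x \<in> H then 1 else (0::real))"
      by (intro sum.cong) auto
    also have "\<dots> = real (card H)"
      using H by (simp add: sum.If_cases Int_absorb1)
    finally show ?thesis .
  qed
  ultimately show ?thesis
    using K c q by (simp add: indicator_expansion_def norm_divide sum_divide_distrib[symmetric] field_simps)
qed

text \<open>
  All \<open>q\<close>-th roots of unity sum to zero, so the sum over \<open>H\<close> is minus the one over the complement.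
\<close>

lemma norm_idem_at_1_le_complement:
  assumes q: "q \<ge> 2" and H: "H \<subseteq> {0..<int q}"
  shows "cmod (idem q H 1) \<le> q - real (card H)"
proof -
  have "(\<Sum>h\<in>{0..<int q}. zq_char q h 1) = 0"
    using sum_zq_char[of q 1] q by (simp add: zq_char_commute[of q _ 1])
  then have "idem q H 1 = - (\<Sum>h\<in>{0..<int q} - H. zq_char q h 1)"
    unfolding idem_def using sum.subset_diff[OF H, of "\<lambda>h. zq_char q h 1"] by (simp add: eq_neg_iff_add_eq_0 add.commute)
  also have "cmod \<dots> \<le> (\<Sum>h\<in>{0..<int q} - H. 1)"
    unfolding norm_minus_cancel by (rule sum_norm_le) simp
  also have "\<dots> = q - real (card H)"
    using H card_mono[OF _ H] by (simp add: card_Diff_subset finite_subset[OF H] of_nat_diff)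
  finally show ?thesis .
qed

text \<open>
  Concentration at exponent \<open>p \<le> 1\<close> bounds \<open>card H = f 0\<close> by a multiple of \<open>|f 1|\<close>, and all other values
  are at most \<open>f 0\<close>. Interpolating between \<open>p\<close> and this supremum bound gives concentration at
  exponent \<open>1\<close>. Parseval then prevents \<open>H\<close> from being sparse, and since \<open>|f 1|\<close> is at most the size of the
  complement, the complement is not sparse either.
\<close>

lemma concentrated_imp_indicator_expansion:
  assumes q: "prime q" and \<gamma>: "\<gamma> > 0" and conc: "concentrated p q \<gamma>" and p: "0 < p" "p \<le> 1"
  shows "\<exists>u b. indicator_expansion (max 1 ((2 / \<gamma>) powr (1 / p))) (1 / (max 1 ((2 / \<gamma>) powr (1 / p)))\<^sup>2) q u b"
proof -
  define K0 where "K0 = (2 / \<gamma>) powr (1 / p)"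
  define K where "K = max 1 K0"
  have q2: "q \<ge> 2" using q prime_ge_2_nat by blast
  obtain H where H: "H \<subseteq> {0..<int q}"
    and nz: "idem q H \<noteq> (\<lambda>_. 0)"
    and c: "\<gamma> * (\<Sum>k\<in>{0..<int q}. cmod (idem q H k) powr p) \<le> 2 * cmod (idem q H 1) powr p"
    using conc unfolding concentrated_iff by blast
  define f where "f = idem q H"
  define n where "n = card H"
  have fin: "finite H" using H finite_subset by blast
  have n0: "n > 0" using nz fin by (auto simp: n_def card_gt_0_iff idem_def fun_eq_iff)
  have f0: "f 0 = of_nat n" by (simp add: f_def idem_0 n_def)
  have f_le: "cmod (f k) \<le> n" for k
    using sum_norm_le[of H "\<lambda>h. zq_char q h k" "\<lambda>_. 1"] by (simp add: f_def idem_def n_def)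
  have K0_ge: "K0 \<ge> 0" by (simp add: K0_def)
  have K0_p: "K0 powr p = 2 / \<gamma>"
    using p \<gamma> by (simp add: K0_def powr_powr)
  have main: "(\<Sum>k\<in>{0..<int q}. cmod (f k) powr p) \<le> 2 / \<gamma> * cmod (f 1) powr p"
    using c \<gamma> by (simp add: f_def field_simps)
  have "n powr p = cmod (f 0) powr p"
    by (simp add: f0)
  also have "\<dots> \<le> (\<Sum>k\<in>{0..<int q}. cmod (f k) powr p)"
    using q2 by (intro member_le_sum) auto
  also have "\<dots> \<le> (K0 * cmod (f 1)) powr p"
    using main \<gamma> K0_ge by (simp add: powr_mult K0_p)
  finally have n_le: "n \<le> K0 * cmod (f 1)"
    using p K0_ge n0 by (meson linorder_not_less mult_nonneg_nonneg norm_ge_zero of_nat_0_le_iff powr_less_mono2)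
  have "(\<Sum>k\<in>{0..<int q}. cmod (f k)) \<le> (\<Sum>k\<in>{0..<int q}. cmod (f k) powr p * n powr (1 - p))"
  proof (intro sum_mono)
    fix k
    have "cmod (f k) = cmod (f k) powr p * cmod (f k) powr (1 - p)"
      by (cases "f k = 0") (auto simp flip: powr_add)
    also have "\<dots> \<le> cmod (f k) powr p * n powr (1 - p)"
      using f_le p by (intro mult_left_mono powr_mono2) auto
    finally show "cmod (f k) \<le> cmod (f k) powr p * n powr (1 - p)" .
  qed
  also have "\<dots> \<le> (K0 * cmod (f 1)) powr p * (K0 * cmod (f 1)) powr (1 - p)"
    unfolding sum_distrib_right[symmetric] using main \<gamma> n_le p
    by (intro mult_mono powr_mono2) (auto simp: powr_mult K0_p K0_ge intro: sum_nonneg)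
  also have "\<dots> = K0 * cmod (f 1)"
    using n_le n0 by (simp flip: powr_add)
  also have "\<dots> \<le> K * cmod (f 1)"
    by (intro mult_right_mono) (auto simp: K_def)
  finally have l1: "(\<Sum>k\<in>{0..<int q}. cmod (f k)) \<le> K * cmod (f 1)" .
  have K1: "K \<ge> 1" by (simp add: K_def)
  have "real q * n = (\<Sum>k\<in>{0..<int q}. (cmod (f k))\<^sup>2)"
    using Parseval_set[of q H] H q2 by (simp add: f_def idem_def n_def)
  also have "\<dots> \<le> (\<Sum>k\<in>{0..<int q}. n * cmod (f k))"
    using f_le by (intro sum_mono) (simp add: power2_eq_square mult_right_mono)
  also have "\<dots> \<le> n * (K * n)"
    unfolding sum_distrib_left[symmetric] using l1 f_le[of 1] K1
    by (intro mult_left_mono) (auto intro: order_trans mult_left_mono)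
  finally have q_le: "q \<le> K * n"
    using n0 by (simp add: mult.commute)
  have "n = cmod (f 0)"
    by (simp add: f0)
  also have "\<dots> \<le> (\<Sum>k\<in>{0..<int q}. cmod (f k))"
    using q2 by (intro member_le_sum) auto
  also have "\<dots> \<le> K * (real q - n)"
    using l1 norm_idem_at_1_le_complement[OF q2 H] K1
    by (intro order_trans[OF l1] mult_left_mono) (auto simp: f_def n_def)
  finally have n_le': "n \<le> K * (q - real n)" .
  have "q \<le> K * n" by (rule q_le)
  also have "\<dots> \<le> K * (K * (q - real n))"
    using n_le' K1 by (intro mult_left_mono) auto
  finally have c_upper: "real n \<le> (1 - 1 / K\<^sup>2) * q"
    using K1 by (simp add: field_simps power2_eq_square)
  have "K * n \<le> K * (K * n)"
    using K1 mult_right_mono[of 1 K "real n"] by (intro mult_left_mono) auto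
  with q_le have "q \<le> K * (K * n)"
    by (rule order_trans)
  then have c_lower: "1 / K\<^sup>2 * q \<le> n"
    using K1 by (simp add: field_simps power2_eq_square)
  have "K * cmod (f 1) \<le> K * q"
    using f_le[of 1] K1 card_mono[OF _ H] by (intro mult_left_mono) (auto simp: n_def)
  then have "indicator_expansion K (1 / K\<^sup>2) q (\<lambda>x. of_bool (x mod int q \<in> H)) (\<lambda>k. cnj (f k) / q)"
    using l1 c_lower c_upper q2 by (intro indicator_expansion_set[OF _ H f_def]) (auto simp: n_def)
  then show ?thesis
    unfolding K_def K0_def by blast
qed

theorem no_uniform_concentration:
  assumes "0 < p" "p \<le> 1"
  shows "\<not> uniform_concentration p"
proof
  assume "uniform_concentration p"
  then obtain \<gamma> where \<gamma>: "\<gamma> > 0" and conc: "\<And>q. prime q \<Longrightarrow> concentrated p q \<gamma>"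
    by (auto simp: uniform_concentration_def)
  define K where "K = max 1 ((2 / \<gamma>) powr (1 / p))"
  have "K \<ge> 1" "1 / K\<^sup>2 > 0"
    by (auto simp: K_def)
  then obtain Q where Q: "\<And>q u b. prime q \<Longrightarrow> q > Q \<Longrightarrow> \<not> indicator_expansion K (1 / K\<^sup>2) q u b"
    using no_indicator_expansion by blast
  obtain q where "prime q" "q > Q"
    using bigger_prime by blast
  then show False
    using Q concentrated_imp_indicator_expansion[OF _ \<gamma> conc assms, of q] by (auto simp: K_def)
qed

section \<open>Concentration of idempotents modulo primes\<close>

theorem theorem6:
  shows "(\<forall>p::real. 1 < p \<longrightarrow> uniform_concentration p) \<and>
    gamma_sharp 2 = (SUP x\<in>{0<..}. ereal (2 * (sin x)\<^sup>2 / (pi * x))) \<and>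
    ereal 0.4613 \<le> gamma_sharp 2 \<and> gamma_sharp 2 < ereal 0.4614 \<and>
    ereal 0.495 < gamma_sharp 4 \<and> gamma_sharp 4 \<le> ereal (1 / 2) \<and>
    (\<forall>p::real. 2 < p \<longrightarrow> gamma_sharp p > ereal 0.483) \<and>
    (\<forall>p::real. 0 < p \<and> p \<le> 1 \<longrightarrow> \<not> uniform_concentration p)"
  using uniform_concentration_above_one gamma_sharp_2 gamma_sharp_4 gamma_sharp_above_two
    no_uniform_concentration
  by blast

end
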